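(* Assume that the uniform corkscrew condition and the uniform connectedness condition hold, and that $\underline{\alpha}_0(\bar x)>-t$ for $\mathcal{H}^t$-a.e. $\bar x\in\Gamma$. Then there exists a linear operator $T:\mathcal{N}^{s(\cdot),p}(\Omega)\to L(\Gamma)$ such that, for each $u\in\mathcal{N}^{s(\cdot),p}(\Omega)$, there exists an $\mathcal{H}^t$-measurable set $\Gamma'\subseteq\Gamma$ such that $\mathcal{H}^t(\Gamma\setminus\Gamma')=0$ and, for every $\bar x\in\Gamma'$, $$\lim_{x\to\bar x;\ x\in Q_\lambda(\bar x)}g(x;u)=Tu(\bar x)\quad\text{for all }0<\lambda<1 .$$ Moreover, for every $\bar x\in\Gamma'$ and $0<\beta<(\underline{\alpha}_0(\bar x)+t)/p$, there exists $\delta_\beta=\delta_\beta(\bar x)>0$ with the following property: for each $0<\lambda<1$ there exists $C_{\beta,\lambda}(\bar x)<\infty$ such that $$|Tu(\bar x)-g(x;u)|\le C_{\beta,\lambda}(\bar x)\,\|\bar x-x\|^\beta\quad\text{for all }x\in Q_{\lambda,\delta_\beta}(\bar x).$$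
   Context: Setup. $\Omega\subseteq\mathbb{R}^n$ is open (not necessarily bounded), $1\le p<\infty$, $0\le t<n$, $\Gamma\subseteq\partial\Omega$ is a Borel set of Hausdorff dimension $t$, $0<\delta_\Gamma<1$, and $s:\Omega\to[0,\infty)$, $\theta_\Gamma:\Gamma\to[1,\infty)$ are bounded Borel measurable functions. $B_\rho(x)$ is the open ball, $E_\rho(x):=E\cap B_\rho(x)$ for $E\subseteq\mathbb{R}^n$, $d(x):=\inf_{\bar y\in\partial\Omega}\|\bar y-x\|$, $\mathcal{H}^\tau$ is $\tau$-dimensional Hausdorff measure, $|E|$ is Lebesgue measure, and $L(\Gamma)$ is the space of Borel measurable real functions on $\Gamma$. Function space. For $x\in\Omega$ put $\Psi(x):=B_{d(x)/2}(x)$ and $\Phi(x):=B_{d(x)/6}(x)$. For $u\in L^1(\Omega)$ and Borel $E\subseteq\mathbb{R}^n$, $$\nu^{s(\cdot),p}(E;u):=\int_{\Omega\cap E}\left(\frac1{|\Psi(x)|}\int_{\Psi(x)}\frac{|u(y)-u(x)|}{d(x)^{s(x)}}\,dy\right)^p dx,$$ and $\mathcal{N}^{s(\cdot),p}(\Omega):=\{u\in L^1(\Omega):\nu^{s(\cdot),p}(\Omega;u)<\infty\}$. For $x\in\Omega$, $g(x;u):=\frac1{|\Phi(x)|}\int_{\Phi(x)}u(y)\,dy$. Approach regions. For $\bar x\in\Gamma$, $0<\lambda<1$, $\delta>0$: $Q_\lambda(\bar x):=\{x\in\Omega: d(x)>(\lambda\|\bar x-x\|)^{\theta_\Gamma(\bar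 x)}\}$ and $Q_{\lambda,\delta}(\bar x):=Q_\lambda(\bar x)\cap B_\delta(\bar x)$. Uniform corkscrew condition. There exist $0<\lambda_0,\eta_0<1$ such that for every $\bar x\in\Gamma$ and every $0<\delta\le\delta_\Gamma$ there is $x\in Q_{\lambda_0}(\bar x)$ with $\eta_0\delta<\|\bar x-x\|<\delta$ and $d(x)>(\eta_0\delta)^{\theta_\Gamma(\bar x)}$. Connectedness. For $C,\theta\ge1$, a set $E\subseteq\Omega$ is $(C,\theta)$-connected to $\bar x\in\partial\Omega$ if there exists $\rho_0>0$ such that for each $0<\lambda<1$ there is $0<\varepsilon_\lambda\le\lambda$ such that for any $0<\rho\le\rho_0$: whenever $x,x'\in E_\rho(\bar x)$ and $d(x),d(x')\ge(\lambda\rho)^\theta$, there is a rectifiable path $\gamma:[0,1]\to E$ between $x$ and $x'$ with $\mathcal{H}^1(\gamma([0,1]))\le C\rho$ and $d(\gamma(\tau))\ge\varepsilon_\lambda\rho^\theta$ for all $\tau\in[0,1]$. (Without loss of generality $\varepsilon_\lambda\le\varepsilon_{\lambda'}$ if $\lambda\le\lambda'$.) Uniform connectedness condition. There exists $C_\Gamma\ge1$ such that for each $\bar x\in\Gamma$ the set $\Omega_{\delta_\Gamma}(\bar x)$ is $(C_\Gamma,\theta_\Gamma(\bar x))$-connected to $\bar x$. Exponents. Define $\alpha(\sigma,\theta):=p(1-\theta)+(p\sigma-n)\theta$ if $p\sigma-n\le p-1$, and $\alpha(\sigma,\theta):=(1-\theta)+(p\sigma-n)$ if $p\sigma-n>p-1$.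 For $\bar x\in\Gamma$ and $0<\delta\le\delta_\Gamma$: $\underline{s}_\delta(\bar x):=\inf_{x\in\Omega_\delta(\bar x)}s(x)$, $\underline{\alpha}_\delta(\bar x):=\alpha(\underline{s}_\delta(\bar x),\theta_\Gamma(\bar x))$, $\underline{\alpha}_0(\bar x):=\lim_{\delta\to0^+}\underline{\alpha}_\delta(\bar x)$. *)

theory Defs
  imports "HOL-Analysis.Analysis"
begin

text \<open>
  The normalization makes the \<open>n\<close>-dimensional measure on an \<open>n\<close>-dimensional space
  agree with Lebesgue measure, and gives a cover weight of \<open>diameter U\<close> for \<open>\<tau> = 1\<close>.
  The case \<open>\<tau> = 0\<close> is separate because \<open>0 powr 0 = 0\<close>, whereas singletons must have
  counting weight 1.
\<close>
definition hausdorff_weight :: "real \<Rightarrow> 'a::metric_space set \<Rightarrow> ennreal" where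
  "hausdorff_weight \<tau> U =
     (if U = {} then 0
      else if \<tau> = 0 then 1
      else ennreal (unit_ball_vol \<tau> * (diameter U / 2) powr \<tau>))"

text \<open>Boundedness is required explicitly, as \<open>diameter\<close> is meaningless on unbounded sets.\<close>
definition hausdorff_content :: "real \<Rightarrow> real \<Rightarrow> 'a::metric_space set \<Rightarrow> ennreal" where
  "hausdorff_content \<tau> \<delta> A =
     (INF U \<in> {U :: nat \<Rightarrow> 'a set. A \<subseteq> (\<Union>i. U i) \<and> (\<forall>i. bounded (U i) \<and> diameter (U i) \<le> \<delta>)}.
        \<Sum>i. hausdorff_weight \<tau> (U i))"

text \<open>An outer measure, defined on all subsets.\<close>
definition hausdorff :: "real \<Rightarrow> 'a::metric_space set \<Rightarrow> ennreal" where
  "hausdorff \<tau> A = (SUP \<delta>\<in>{0<..}. hausdorff_content \<tau> \<delta> A)"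

text \<open>Measurability in the sense of Caratheodory.\<close>
definition hausdorff_measurable :: "real \<Rightarrow> 'a::metric_space set \<Rightarrow> bool" where
  "hausdorff_measurable \<tau> A \<longleftrightarrow> A \<in> lambda_system UNIV (Pow UNIV) (hausdorff \<tau>)"

definition hausdorff_dim :: "'a::metric_space set \<Rightarrow> ennreal" where
  "hausdorff_dim A = (INF \<tau>\<in>{\<tau>. 0 \<le> \<tau> \<and> hausdorff \<tau> A = 0}. ennreal \<tau>)"

text \<open>
  If \<open>frontier \<Omega>\<close> is empty, \<open>infdist\<close> yields 0 instead of infinity; subsets of the frontier
  are then empty as well.
\<close>
definition bdist :: "'a::euclidean_space set \<Rightarrow> 'a \<Rightarrow> real" where
  "bdist \<Omega> x = infdist x (frontier \<Omega>)"

definition Psi :: "'a::euclidean_space set \<Rightarrow> 'a \<Rightarrow> 'a set" where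
  "Psi \<Omega> x = ball x (bdist \<Omega> x / 2)"

definition Phi :: "'a::euclidean_space set \<Rightarrow> 'a \<Rightarrow> 'a set" where
  "Phi \<Omega> x = ball x (bdist \<Omega> x / 6)"

text \<open>
  Only used for \<open>u\<close> integrable on \<open>\<Omega>\<close>; the inner integral then exists for every \<open>x \<in> \<Omega>\<close>
  as a real Bochner integral, because \<open>Psi \<Omega> x\<close> is a bounded subset of \<open>\<Omega>\<close>.
\<close>
definition nu :: "'a::euclidean_space set \<Rightarrow> ('a \<Rightarrow> real) \<Rightarrow> real \<Rightarrow> 'a set \<Rightarrow> ('a \<Rightarrow> real) \<Rightarrow> ennreal" where
  "nu \<Omega> s p E u =
     (\<integral>\<^sup>+ x \<in> \<Omega> \<inter> E.
        ennreal ((1 / measure lebesgue (Psi \<Omega> x) *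
          (LINT y:Psi \<Omega> x|lebesgue. \<bar>u y - u x\<bar> / bdist \<Omega> x powr s x)) powr p) \<partial>lebesgue)"

text \<open>Elements are representatives of the almost-everywhere classes forming \<open>L\<^sup>1(\<Omega>)\<close>.\<close>
definition Nspace :: "'a::euclidean_space set \<Rightarrow> ('a \<Rightarrow> real) \<Rightarrow> real \<Rightarrow> ('a \<Rightarrow> real) set" where
  "Nspace \<Omega> s p = {u. integrable (lebesgue_on \<Omega>) u \<and> nu \<Omega> s p \<Omega> u < \<infinity>}"

definition gmean :: "'a::euclidean_space set \<Rightarrow> 'a \<Rightarrow> ('a \<Rightarrow> real) \<Rightarrow> real" where
  "gmean \<Omega> x u = 1 / measure lebesgue (Phi \<Omega> x) * (LINT y:Phi \<Omega> x|lebesgue. u y)"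

definition Lspace :: "'a::euclidean_space set \<Rightarrow> ('a \<Rightarrow> real) set" where
  "Lspace \<Gamma> = borel_measurable (restrict_space borel \<Gamma>)"

text \<open>
  Linear operators from \<open>Nspace \<Omega> s p\<close> to \<open>Lspace \<Gamma>\<close>. Elements of the target are functions
  on \<open>\<Gamma>\<close>, so equalities there are tested pointwise on \<open>\<Gamma>\<close> only. The last clause says that
  \<open>T\<close> is well defined on almost-everywhere classes.
\<close>
definition linear_operator ::
  "'a::euclidean_space set \<Rightarrow> ('a \<Rightarrow> real) \<Rightarrow> real \<Rightarrow> 'a set \<Rightarrow> (('a \<Rightarrow> real) \<Rightarrow> 'a \<Rightarrow> real) \<Rightarrow> bool" where
  "linear_operator \<Omega> s p \<Gamma> T \<longleftrightarrow>
     (\<forall>u\<in>Nspace \<Omega> s p. T u \<in> Lspace \<Gamma>) \<and>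
     (\<forall>u\<in>Nspace \<Omega> s p. \<forall>v\<in>Nspace \<Omega> s p. \<forall>z\<in>\<Gamma>. T (\<lambda>x. u x + v x) z = T u z + T v z) \<and>
     (\<forall>c. \<forall>u\<in>Nspace \<Omega> s p. \<forall>z\<in>\<Gamma>. T (\<lambda>x. c * u x) z = c * T u z) \<and>
     (\<forall>u\<in>Nspace \<Omega> s p. \<forall>v\<in>Nspace \<Omega> s p.
        (AE x in lebesgue_on \<Omega>. u x = v x) \<longrightarrow> (\<forall>z\<in>\<Gamma>. T u z = T v z))"

definition Qreg :: "'a::euclidean_space set \<Rightarrow> ('a \<Rightarrow> real) \<Rightarrow> real \<Rightarrow> 'a \<Rightarrow> 'a set" where
  "Qreg \<Omega> \<theta> lam z = {x\<in>\<Omega>. bdist \<Omega> x > (lam * norm (z - x)) powr \<theta> z}"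

definition Qreg_loc :: "'a::euclidean_space set \<Rightarrow> ('a \<Rightarrow> real) \<Rightarrow> real \<Rightarrow> real \<Rightarrow> 'a \<Rightarrow> 'a set" where
  "Qreg_loc \<Omega> \<theta> lam \<delta> z = Qreg \<Omega> \<theta> lam z \<inter> ball z \<delta>"

definition uniform_corkscrew ::
  "'a::euclidean_space set \<Rightarrow> 'a set \<Rightarrow> ('a \<Rightarrow> real) \<Rightarrow> real \<Rightarrow> bool" where
  "uniform_corkscrew \<Omega> \<Gamma> \<theta> \<delta>\<Gamma> \<longleftrightarrow>
     (\<exists>lam0 \<eta>0. 0 < lam0 \<and> lam0 < 1 \<and> 0 < \<eta>0 \<and> \<eta>0 < 1 \<and>
        (\<forall>z\<in>\<Gamma>. \<forall>\<delta>. 0 < \<delta> \<and> \<delta> \<le> \<delta>\<Gamma> \<longrightarrow>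
           (\<exists>x\<in>Qreg \<Omega> \<theta> lam0 z. \<eta>0 * \<delta> < norm (z - x) \<and> norm (z - x) < \<delta> \<and>
              bdist \<Omega> x > (\<eta>0 * \<delta>) powr \<theta> z)))"

text \<open>
  A path of finite length, i.e. of bounded variation; \<open>\<tau> 0, \<dots>, \<tau> m\<close> are the points of a
  partition of the unit interval.
\<close>
definition rectifiable_path :: "(real \<Rightarrow> 'a::euclidean_space) \<Rightarrow> bool" where
  "rectifiable_path \<gamma> \<longleftrightarrow> path \<gamma> \<and>
     (\<exists>L. \<forall>(m::nat) (\<tau>::nat \<Rightarrow> real). mono_on {..m} \<tau> \<and> \<tau> ` {..m} \<subseteq> {0..1} \<longrightarrow>
        (\<Sum>i<m. dist (\<gamma> (\<tau> i)) (\<gamma> (\<tau> (Suc i)))) \<le> L)"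

definition connected_to ::
  "'a::euclidean_space set \<Rightarrow> real \<Rightarrow> real \<Rightarrow> 'a set \<Rightarrow> 'a \<Rightarrow> bool" where
  "connected_to \<Omega> C \<theta> E z \<longleftrightarrow>
     (\<exists>\<rho>0>0. \<forall>lam. 0 < lam \<and> lam < 1 \<longrightarrow>
        (\<exists>\<epsilon>. 0 < \<epsilon> \<and> \<epsilon> \<le> lam \<and>
           (\<forall>\<rho>. 0 < \<rho> \<and> \<rho> \<le> \<rho>0 \<longrightarrow>
              (\<forall>x\<in>E \<inter> ball z \<rho>. \<forall>x'\<in>E \<inter> ball z \<rho>.
                 bdist \<Omega> x \<ge> (lam * \<rho>) powr \<theta> \<and> bdist \<Omega> x' \<ge> (lam * \<rho>) powr \<theta> \<longrightarrow>
                 (\<exists>\<gamma>. rectifiable_path \<gamma> \<and> path_image \<gamma> \<subseteq> E \<and>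
                    pathstart \<gamma> = x \<and> pathfinish \<gamma> = x' \<and>
                    hausdorff 1 (path_image \<gamma>) \<le> ennreal (C * \<rho>) \<and>
                    (\<forall>\<tau>\<in>{0..1}. bdist \<Omega> (\<gamma> \<tau>) \<ge> \<epsilon> * \<rho> powr \<theta>))))))"

definition uniformly_connected ::
  "'a::euclidean_space set \<Rightarrow> 'a set \<Rightarrow> ('a \<Rightarrow> real) \<Rightarrow> real \<Rightarrow> bool" where
  "uniformly_connected \<Omega> \<Gamma> \<theta> \<delta>\<Gamma> \<longleftrightarrow>
     (\<exists>C\<ge>1. \<forall>z\<in>\<Gamma>. connected_to \<Omega> C (\<theta> z) (\<Omega> \<inter> ball z \<delta>\<Gamma>) z)"

definition alpha_exp :: "real \<Rightarrow> real \<Rightarrow> real \<Rightarrow> real \<Rightarrow> real" where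
  "alpha_exp n p \<sigma> \<theta> =
     (if p * \<sigma> - n \<le> p - 1 then p * (1 - \<theta>) + (p * \<sigma> - n) * \<theta>
      else (1 - \<theta>) + (p * \<sigma> - n))"

definition s_lower :: "'a::euclidean_space set \<Rightarrow> ('a \<Rightarrow> real) \<Rightarrow> real \<Rightarrow> 'a \<Rightarrow> real" where
  "s_lower \<Omega> s \<delta> z = (INF x\<in>\<Omega> \<inter> ball z \<delta>. s x)"

definition alpha_lower ::
  "'a::euclidean_space set \<Rightarrow> ('a \<Rightarrow> real) \<Rightarrow> real \<Rightarrow> ('a \<Rightarrow> real) \<Rightarrow> real \<Rightarrow> 'a \<Rightarrow> real" where
  "alpha_lower \<Omega> s p \<theta> \<delta> z = alpha_exp (real DIM('a)) p (s_lower \<Omega> s \<delta> z) (\<theta> z)"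

text \<open>
  For \<open>z\<close> in the frontier and bounded \<open>s\<close> the limit exists, because \<open>alpha_exp n p \<sigma> \<theta>\<close> is
  continuous and nondecreasing in \<open>\<sigma>\<close>.
\<close>
definition alpha_zero ::
  "'a::euclidean_space set \<Rightarrow> ('a \<Rightarrow> real) \<Rightarrow> real \<Rightarrow> ('a \<Rightarrow> real) \<Rightarrow> 'a \<Rightarrow> real" where
  "alpha_zero \<Omega> s p \<theta> z = Lim (at_right 0) (\<lambda>\<delta>. alpha_lower \<Omega> s p \<theta> \<delta> z)"

end

theory Submission
  imports Defs "HOL-Library.Function_Algebras"
begin

text \<open>
  If \<open>x\<close> and \<open>y\<close> are closer than \<open>d(x)/14\<close>, then \<open>\<Phi>(y) \<subseteq> \<Psi>(w)\<close> for all \<open>w \<in> \<Phi>(x)\<close>, so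
  \<open>\<bar>g(x) - g(y)\<bar>\<close> is at most a multiple of \<open>d(x)\<close> to the power \<open>\<sigma> - n/p\<close>, times
  \<open>\<nu>(\<Phi>(x))\<close> to the power \<open>1/p\<close>. Two points of \<open>Q\<^sub>\<lambda>\<close> at distance about \<open>\<rho>\<close> from \<open>z\<close> are joined
  inside the given continuum of length \<open>C\<rho>\<close> by a chain of such steps with \<open>\<Sum> d(x\<^sub>i)\<close> of order
  \<open>\<rho>\<close>. At almost every \<open>z\<close> the mass of \<open>\<nu>\<close> in a ball of radius \<open>r\<close> around \<open>z\<close> is of order at most
  \<open>r\<close> to the power \<open>t\<close>; this makes the sum of the steps of order at most \<open>\<rho>\<close> to the power \<open>\<beta>\<close>, and
  comparing dyadic corkscrew points gives the limit together with its rate.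

  The exceptional set depends on \<open>u\<close>, so limits alone do not define an operator that is linear
  at every point of \<open>\<Gamma>\<close>. Therefore \<open>T\<close> is prescribed on a Hamel basis and extended linearly: an
  element is a combination of finitely many basis vectors, and null sets are closed under finite
  unions. The basis extends one of the space of functions vanishing almost everywhere, on which
  \<open>T\<close> is zero.
\<close>

subsection \<open>Hausdorff outer measures\<close>

text \<open>Origin of the exponent: put e = \<sigma> - n/p - 1. Up to constants, a step from x costs
  d(x)^e * d(x) times \<rho>^(t/p), the latter from the density of \<nu>. On the continuum d lies
  between \<epsilon> \<rho>^\<theta> and (C + 1) \<rho>, so d^e is of order at most \<rho>^(\<theta>
  e) if e \<le> 0 and \<rho>^e if e > 0. The remaining factor d is why the chain is controlled
  through the sum of the d(x_i) and not through its number of steps. The total has order \<rho>^(t/p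
  + 1 + e') with e' = \<theta> e or e' = e, and p (1 + e') is at least \<alpha>(\<sigma>, \<theta>).

  The integrand of \<nu> is nowhere shown to be measurable. The density argument therefore uses only
  that \<nu> is monotone and superadditive on disjoint sets, and the averaging estimate only
  compares it from below with an integrable function.

  All radii are fixed before \<lambda>, as the uniformity of \<delta>_\<beta> in \<lambda> demands;
  \<lambda> enters only through constants.\<close>

lemma ennreal_SUP_add_SUP_le:
  fixes f g :: "_ \<Rightarrow> ennreal"
  assumes "I \<noteq> {}" "J \<noteq> {}" "\<And>i j. i \<in> I \<Longrightarrow> j \<in> J \<Longrightarrow> f i + g j \<le> x"
  shows "(SUP i\<in>I. f i) + (SUP j\<in>J. g j) \<le> x"
  unfolding ennreal_SUP_add_left[OF assms(1), symmetric]
  by (intro SUP_least) (simp add: ennreal_SUP_add_right[OF assms(2)] SUP_le_iff assms(3))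

lemma hausdorff_weight_empty [simp]: "hausdorff_weight \<tau> {} = 0"
  by (simp add: hausdorff_weight_def)

lemma hausdorff_content_le:
  assumes "A \<subseteq> (\<Union>i. U i)" "\<And>i. bounded (U i)" "\<And>i. diameter (U i) \<le> \<delta>"
  shows "hausdorff_content \<tau> \<delta> A \<le> (\<Sum>i. hausdorff_weight \<tau> (U i))"
  unfolding hausdorff_content_def using assms by (intro INF_lower) auto

text \<open>Covering theorems produce countable families and bounds for their finite subfamilies,
  whereas the definition asks for a sequence. The enumeration is filled up with empty sets, whose
  weight is 0 even for \<tau> = 0.\<close>

lemma hausdorff_content_countable_le:
  assumes "countable C" "A \<subseteq> (\<Union>c\<in>C. U c)" "\<And>c. c \<in> C \<Longrightarrow> bounded (U c)"
    "\<And>c. c \<in> C \<Longrightarrow> diameter (U c) \<le> \<delta>" "0 \<le> \<delta>"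
    and le: "\<And>F. finite F \<Longrightarrow> F \<subseteq> C \<Longrightarrow> (\<Sum>c\<in>F. hausdorff_weight \<tau> (U c)) \<le> x"
  shows "hausdorff_content \<tau> \<delta> A \<le> x"
proof -
  define V where "V i = (if i \<in> to_nat_on C ` C then U (from_nat_into C i) else {})" for i
  have from_nat: "from_nat_into C i \<in> C" "to_nat_on C (from_nat_into C i) = i"
    if "i \<in> to_nat_on C ` C" for i
    using that assms(1) by auto
  have "hausdorff_content \<tau> \<delta> A \<le> (\<Sum>i. hausdorff_weight \<tau> (V i))"
  proof (rule hausdorff_content_le)
    show "A \<subseteq> (\<Union>i. V i)"
    proof
      fix a assume "a \<in> A"
      with assms(2) obtain c where "c \<in> C" "a \<in> U c" by auto
      then have "a \<in> V (to_nat_on C c)" using assms(1) by (simp add: V_def)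
      then show "a \<in> (\<Union>i. V i)" by blast
    qed
    show "bounded (V i)" "diameter (V i) \<le> \<delta>" for i
      using from_nat[of i] assms(3-5) by (auto simp: V_def)
  qed
  also have "\<dots> \<le> x"
  proof (rule suminf_le_const[OF summableI])
    fix n
    let ?F = "{i. i < n \<and> i \<in> to_nat_on C ` C}"
    have inj: "inj_on (from_nat_into C) ?F"
      using from_nat by (metis (no_types, lifting) inj_onI mem_Collect_eq)
    have "(\<Sum>i<n. hausdorff_weight \<tau> (V i)) = (\<Sum>i\<in>?F. hausdorff_weight \<tau> (U (from_nat_into C i)))"
      by (intro sum.mono_neutral_cong_right) (auto simp: V_def)
    also have "\<dots> = (\<Sum>c\<in>from_nat_into C ` ?F. hausdorff_weight \<tau> (U c))"
      by (simp add: sum.reindex[OF inj])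
    also have "\<dots> \<le> x"
      using from_nat by (intro le) auto
    finally show "(\<Sum>i<n. hausdorff_weight \<tau> (V i)) \<le> x" .
  qed
  finally show ?thesis .
qed

lemma hausdorff_content_empty [simp]: "0 \<le> \<delta> \<Longrightarrow> hausdorff_content \<tau> \<delta> {} = 0"
  using hausdorff_content_countable_le[of "{}" "{}" "\<lambda>_. {}" \<delta> \<tau> 0] by simp

lemma hausdorff_content_mono:
  "A \<subseteq> B \<Longrightarrow> hausdorff_content \<tau> \<delta> A \<le> hausdorff_content \<tau> \<delta> B"
  unfolding hausdorff_content_def by (intro INF_superset_mono) auto

lemma hausdorff_content_antimono:
  "\<delta> \<le> \<delta>' \<Longrightarrow> hausdorff_content \<tau> \<delta>' A \<le> hausdorff_content \<tau> \<delta> A"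
  unfolding hausdorff_content_def by (intro INF_superset_mono) (auto intro: order_trans)

lemma hausdorff_content_UN_le:
  "hausdorff_content \<tau> \<delta> (\<Union>i::nat. A i) \<le> (\<Sum>i. hausdorff_content \<tau> \<delta> (A i))"
proof (rule ennreal_le_epsilon)
  fix e :: real assume e: "0 < e" "(\<Sum>i. hausdorff_content \<tau> \<delta> (A i)) < top"
  then have *: "hausdorff_content \<tau> \<delta> (A n) < hausdorff_content \<tau> \<delta> (A n) + e * (1/2)^Suc n" for n
    by (auto simp add: less_top dest!: ennreal_suminf_lessD)
  have "\<exists>U. A n \<subseteq> (\<Union>i. U i) \<and> (\<forall>i. bounded (U i) \<and> diameter (U i) \<le> \<delta>) \<and>
      (\<Sum>i. hausdorff_weight \<tau> (U i)) \<le> hausdorff_content \<tau> \<delta> (A n) + e * (1/2)^Suc n" for n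
    using *[of n] unfolding hausdorff_content_def[of _ _ "A n"] INF_less_iff
    by (auto dest: less_imp_le)
  then obtain U where U: "\<And>n. A n \<subseteq> (\<Union>i. U n i)" "\<And>n i. bounded (U n i)"
      "\<And>n i. diameter (U n i) \<le> \<delta>"
      "\<And>n. (\<Sum>i. hausdorff_weight \<tau> (U n i)) \<le> hausdorff_content \<tau> \<delta> (A n) + e * (1/2)^Suc n"
    by metis
  define V where "V = case_prod U \<circ> prod_decode"
  have "hausdorff_content \<tau> \<delta> (\<Union>i. A i) \<le> (\<Sum>i. hausdorff_weight \<tau> (V i))"
  proof (rule hausdorff_content_le)
    show "(\<Union>i. A i) \<subseteq> (\<Union>i. V i)"
      using U(1) by (auto simp add: V_def subset_eq) (metis prod.case prod_encode_inverse)
  qed (use U in \<open>auto simp: V_def split: prod.split\<close>)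
  also have "\<dots> = (\<Sum>n. \<Sum>i. hausdorff_weight \<tau> (U n i))"
    unfolding V_def comp_def by (intro suminf_ennreal_2dimen) auto
  also have "\<dots> \<le> (\<Sum>n. hausdorff_content \<tau> \<delta> (A n) + e * (1/2) ^ Suc n)"
    by (intro suminf_le allI U) auto
  also have "\<dots> = (\<Sum>n. hausdorff_content \<tau> \<delta> (A n)) + (\<Sum>n. ennreal e * ennreal ((1/2) ^ Suc n))"
    using \<open>0 < e\<close> by (subst suminf_add[symmetric])
      (auto simp del: ennreal_suminf_cmult simp add: ennreal_mult[symmetric])
  also have "\<dots> = (\<Sum>n. hausdorff_content \<tau> \<delta> (A n)) + e"
    unfolding ennreal_suminf_cmult
    by (subst suminf_ennreal_eq[OF zero_le_power power_half_series]) auto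
  finally show "hausdorff_content \<tau> \<delta> (\<Union>i. A i) \<le> (\<Sum>n. hausdorff_content \<tau> \<delta> (A n)) + e" .
qed

lemma hausdorff_content_le_hausdorff: "0 < \<delta> \<Longrightarrow> hausdorff_content \<tau> \<delta> A \<le> hausdorff \<tau> A"
  unfolding hausdorff_def by (intro SUP_upper) auto

lemma hausdorff_empty [simp]: "hausdorff \<tau> {} = 0"
  unfolding hausdorff_def by (simp add: SUP_constant cong: SUP_cong_simp)

lemma hausdorff_mono: "A \<subseteq> B \<Longrightarrow> hausdorff \<tau> A \<le> hausdorff \<tau> B"
  unfolding hausdorff_def by (intro SUP_mono') (rule hausdorff_content_mono)

lemma hausdorff_UN_le: "hausdorff \<tau> (\<Union>i::nat. A i) \<le> (\<Sum>i. hausdorff \<tau> (A i))"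
  unfolding hausdorff_def[of _ "\<Union>i. A i"]
  by (intro SUP_least order_trans[OF hausdorff_content_UN_le] suminf_le summableI)
    (auto intro: hausdorff_content_le_hausdorff)

text \<open>A cover set of diameter below \<open>e\<close> meets at most one of the two sets, so
  every fine cover of the union splits into a cover of each.\<close>

lemma hausdorff_separated_add_le:
  assumes "0 < e" and sep: "\<And>a b. a \<in> A \<Longrightarrow> b \<in> B \<Longrightarrow> e \<le> dist a b"
  shows "hausdorff \<tau> A + hausdorff \<tau> B \<le> hausdorff \<tau> (A \<union> B)"
  unfolding hausdorff_def[of _ A] hausdorff_def[of _ B]
proof (rule ennreal_SUP_add_SUP_le)
  fix \<delta>1 \<delta>2 :: real assume "\<delta>1 \<in> {0<..}" "\<delta>2 \<in> {0<..}"
  \<comment> \<open>Half of \<open>e\<close>, because covers may attain the diameter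
    \<open>\<delta>\<close> and it has to stay strictly below \<open>e\<close>.\<close>
  define \<delta> where "\<delta> = min (e/2) (min \<delta>1 \<delta>2)"
  have \<delta>: "0 < \<delta>" "\<delta> < e" "\<delta> \<le> \<delta>1" "\<delta> \<le> \<delta>2"
    using \<open>\<delta>1 \<in> _\<close> \<open>\<delta>2 \<in> _\<close> \<open>0 < e\<close> by (auto simp: \<delta>_def)
  have "hausdorff_content \<tau> \<delta> A + hausdorff_content \<tau> \<delta> B \<le> hausdorff_content \<tau> \<delta> (A \<union> B)"
    unfolding hausdorff_content_def[of _ _ "A \<union> B"]
  proof (rule INF_greatest, clarify)
    fix U :: "nat \<Rightarrow> 'a set"
    assume U: "A \<union> B \<subseteq> (\<Union>i. U i)" "\<forall>i. bounded (U i) \<and> diameter (U i) \<le> \<delta>"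
    define V where "V i = (if U i \<inter> A \<noteq> {} then U i else {})" for i
    define W where "W i = (if U i \<inter> B \<noteq> {} then U i else {})" for i
    have "hausdorff_content \<tau> \<delta> A \<le> (\<Sum>i. hausdorff_weight \<tau> (V i))"
      using U \<delta>(1) by (intro hausdorff_content_le) (fastforce simp: V_def)+
    moreover have "hausdorff_content \<tau> \<delta> B \<le> (\<Sum>i. hausdorff_weight \<tau> (W i))"
      using U \<delta>(1) by (intro hausdorff_content_le) (fastforce simp: W_def)+
    ultimately have "hausdorff_content \<tau> \<delta> A + hausdorff_content \<tau> \<delta> B
        \<le> (\<Sum>i. hausdorff_weight \<tau> (V i) + hausdorff_weight \<tau> (W i))"
      by (simp add: add_mono flip: suminf_add)
    also have "\<dots> \<le> (\<Sum>i. hausdorff_weight \<tau> (U i))"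
    proof (intro suminf_le summableI)
      fix i
      have "U i \<inter> A = {} \<or> U i \<inter> B = {}"
      proof (rule ccontr)
        assume "\<not> ?thesis"
        then obtain a b where "a \<in> U i" "a \<in> A" "b \<in> U i" "b \<in> B" by blast
        then have "e \<le> dist a b" "dist a b \<le> diameter (U i)"
          using sep diameter_bounded_bound U(2) by blast+
        then show False using U(2) \<delta>(2) by (meson leD order_trans)
      qed
      then show "hausdorff_weight \<tau> (V i) + hausdorff_weight \<tau> (W i) \<le> hausdorff_weight \<tau> (U i)"
        by (auto simp: V_def W_def)
    qed
    finally show "hausdorff_content \<tau> \<delta> A + hausdorff_content \<tau> \<delta> B
        \<le> (\<Sum>i. hausdorff_weight \<tau> (U i))" .
  qed
  then have "hausdorff_content \<tau> \<delta>1 A + hausdorff_content \<tau> \<delta>2 B \<le> hausdorff_content \<tau> \<delta> (A \<union> B)"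
    using \<delta> by (meson add_mono hausdorff_content_antimono order_trans)
  also have "\<dots> \<le> hausdorff \<tau> (A \<union> B)"
    using \<delta>(1) by (rule hausdorff_content_le_hausdorff)
  finally show "hausdorff_content \<tau> \<delta>1 A + hausdorff_content \<tau> \<delta>2 B \<le> hausdorff \<tau> (A \<union> B)" .
qed auto

lemma hausdorff_outer_measure_space:
  "outer_measure_space (Pow UNIV) (hausdorff \<tau> :: 'a::metric_space set \<Rightarrow> ennreal)"
  unfolding outer_measure_space_def positive_def increasing_def countably_subadditive_def
  by (auto intro: hausdorff_mono hausdorff_UN_le)

lemma hausdorff_Un_le: "hausdorff \<tau> (A \<union> B) \<le> hausdorff \<tau> A + hausdorff \<tau> B"
proof -
  have "hausdorff \<tau> (A \<union> B) \<le> hausdorff \<tau> (\<Union>i. binaryset A B i)"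
    by (simp add: UN_binaryset_eq)
  also have "\<dots> \<le> (\<Sum>i. hausdorff \<tau> (binaryset A B i))"
    by (rule hausdorff_UN_le)
  also have "\<dots> = hausdorff \<tau> A + hausdorff \<tau> B"
    by (rule suminf_binaryset_eq) simp
  finally show ?thesis .
qed

lemma hausdorff_null_Un: "hausdorff \<tau> A = 0 \<Longrightarrow> hausdorff \<tau> B = 0 \<Longrightarrow> hausdorff \<tau> (A \<union> B) = 0"
  using hausdorff_Un_le[of \<tau> A B] by simp

section \<open>Caratheodory measurability of Borel sets\<close>

lemma hausdorff_measurableI:
  assumes "\<And>A. hausdorff \<tau> A < \<infinity> \<Longrightarrow> hausdorff \<tau> (A \<inter> C) + hausdorff \<tau> (A - C) \<le> hausdorff \<tau> A"
  shows "hausdorff_measurable \<tau> C"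
proof -
  have "hausdorff \<tau> (A \<inter> C) + hausdorff \<tau> (A - C) = hausdorff \<tau> A" for A
  proof (rule antisym)
    show "hausdorff \<tau> (A \<inter> C) + hausdorff \<tau> (A - C) \<le> hausdorff \<tau> A"
      using assms[of A] by (cases "hausdorff \<tau> A = \<infinity>") (auto simp: less_top)
    show "hausdorff \<tau> A \<le> hausdorff \<tau> (A \<inter> C) + hausdorff \<tau> (A - C)"
      using hausdorff_Un_le[of \<tau> "A \<inter> C" "A - C"] by (simp add: Int_Diff_Un)
  qed
  then show ?thesis
    unfolding hausdorff_measurable_def lambda_system_def
    by (simp add: Int_commute Diff_eq)
qed

lemma hausdorff_null_measurable:
  assumes "hausdorff \<tau> N = 0" shows "hausdorff_measurable \<tau> N"
proof (rule hausdorff_measurableI)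
  fix A
  have "hausdorff \<tau> (A \<inter> N) = 0"
    using hausdorff_mono[of "A \<inter> N" N \<tau>] assms by simp
  then show "hausdorff \<tau> (A \<inter> N) + hausdorff \<tau> (A - N) \<le> hausdorff \<tau> A"
    by (simp add: hausdorff_mono)
qed

text \<open>
  Caratheodory's criterion: the part of \<open>A\<close> outside \<open>C\<close> is cut into shells according to the
  distance from \<open>C\<close>. Shells of equal parity are separated, so their measures are summable, and
  what lies close to \<open>C\<close> is negligible.
\<close>
lemma hausdorff_measurable_closed:
  fixes C :: "'a::metric_space set"
  assumes "closed C" shows "hausdorff_measurable \<tau> C"
proof (cases "C = {}")
  case True
  then show ?thesis by (auto intro: hausdorff_measurableI)
next
  case ne: False
  let ?d = "\<lambda>x. infdist x C"
  show ?thesis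
  proof (rule hausdorff_measurableI)
    fix A :: "'a set" assume fin: "hausdorff \<tau> A < \<infinity>"
    define D where "D k = {x\<in>A. 1 / real (Suc k) \<le> ?d x}" for k
    define R where "R k = {x\<in>A. 1 / real (Suc (Suc k)) \<le> ?d x \<and> ?d x < 1 / real (Suc k)}" for k
    have shell: "(\<Sum>i<n. hausdorff \<tau> (R (2*i+b))) \<le> hausdorff \<tau> (\<Union>i<n. R (2*i+b))" for n b
    proof (induction n)
      case (Suc n)
      let ?e = "1 / real (2*n+b) - 1 / real (Suc (2*n+b))"
      have "hausdorff \<tau> (\<Union>i<n. R (2*i+b)) + hausdorff \<tau> (R (2*n+b))
          \<le> hausdorff \<tau> ((\<Union>i<n. R (2*i+b)) \<union> R (2*n+b))"
      \<comment> \<open>For \<open>n = 0\<close> the union is empty, while \<open>?e\<close> is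
        negative if also \<open>b = 0\<close>, because 1 / 0 = 0. Otherwise the earlier shells lie
        at distance at least 1 / (2n + b) from \<open>C\<close>, the new one at distance less than 1
        / (2n + b + 1).\<close>
      proof (cases "n = 0")
        case False
        show ?thesis
        proof (rule hausdorff_separated_add_le[of ?e])
          have "1 / real (Suc (2*n+b)) < 1 / real (2*n+b)"
            using False by (intro divide_strict_left_mono) auto
          then show "0 < ?e" by simp
          fix x y assume "x \<in> (\<Union>i<n. R (2*i+b))" "y \<in> R (2*n+b)"
          then obtain i where i: "i < n" "1 / real (Suc (Suc (2*i+b))) \<le> ?d x"
            and y: "?d y < 1 / real (Suc (2*n+b))"
            by (auto simp: R_def)
          have "1 / real (2*n+b) \<le> 1 / real (Suc (Suc (2*i+b)))"
            using i(1) by (intro divide_left_mono) auto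
          then show "?e \<le> dist x y"
            using i(2) y infdist_triangle[of x C y] by linarith
        qed
      qed simp
      with Suc show ?case
        by (simp add: lessThan_Suc Un_commute add.commute)
          (meson add_left_mono order_trans)
    qed simp
    have half: "(\<Sum>i<n. hausdorff \<tau> (R (2*i+b))) \<le> hausdorff \<tau> A" for n b
      by (rule order_trans[OF shell]) (auto simp: R_def intro!: hausdorff_mono)
    have double: "(\<Sum>i<2*n. f i) = (\<Sum>i<n. f (2*i)) + (\<Sum>i<n. f (2*i+1))"
      for f :: "nat \<Rightarrow> ennreal" and n
      by (induction n) (auto simp: ac_simps)
    have "(\<Sum>i<n. hausdorff \<tau> (R i)) \<le> hausdorff \<tau> A + hausdorff \<tau> A" for n
    proof -
      have "(\<Sum>i<n. hausdorff \<tau> (R i)) \<le> (\<Sum>i<2*n. hausdorff \<tau> (R i))"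
        by (intro sum_mono2) auto
      also have "\<dots> \<le> hausdorff \<tau> A + hausdorff \<tau> A"
        unfolding double using half[where b=0] half[where b=1] by (intro add_mono) auto
      finally show ?thesis .
    qed
    then have "(\<Sum>i. hausdorff \<tau> (R i)) \<le> hausdorff \<tau> A + hausdorff \<tau> A"
      by (intro suminf_le_const summableI)
    with fin have sum_fin: "(\<Sum>i. hausdorff \<tau> (R i)) \<noteq> \<infinity>"
      by (metis ennreal_add_eq_top infinity_ennreal_def less_irrefl top_unique)
    \<comment> \<open>The tail of the series bounds what lies close to \<open>C\<close>. Adding the
      head on the left completes it to the full sum and avoids subtraction in
      \<open>ennreal\<close>; the bound is uniform in \<open>k\<close>, so the head may be replaced
      by its supremum and the finite sum cancelled.\<close>
    have "(\<Sum>i<k. hausdorff \<tau> (R i)) + (hausdorff \<tau> (A \<inter> C) + hausdorff \<tau> (A - C))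
        \<le> (\<Sum>i. hausdorff \<tau> (R i)) + hausdorff \<tau> A" for k
    proof -
      have "A - C \<subseteq> D k \<union> (\<Union>i. R (i + k))"
      proof
        fix x assume x: "x \<in> A - C"
        then have "0 < ?d x"
          using assms ne by (metis DiffD2 in_closed_iff_infdist_zero infdist_nonneg order_le_less)
        show "x \<in> D k \<union> (\<Union>i. R (i + k))"
        proof (cases "x \<in> D k")
          case False
          then have k: "?d x < 1 / real (Suc k)" using x by (simp add: D_def)
          obtain m where m: "1 / real (Suc m) < ?d x"
            using reals_Archimedean[OF \<open>0 < ?d x\<close>] by (auto simp: inverse_eq_divide)
          \<comment> \<open>Minimality makes the inequality fail at l - 1, which puts
            \<open>x\<close> into the shell with index l - 1; this index is at least
            \<open>k\<close> because \<open>x\<close> is not in \<open>D k\<close>.\<close>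
          define l where "l = (LEAST m. 1 / real (Suc m) \<le> ?d x)"
          have l: "1 / real (Suc l) \<le> ?d x"
            unfolding l_def by (rule LeastI[of _ m]) (use m in simp)
          have "k < l"
          proof (rule ccontr)
            assume "\<not> k < l"
            then have "1 / real (Suc k) \<le> 1 / real (Suc l)" by (intro divide_left_mono) auto
            with l k show False by linarith
          qed
          then obtain j where j: "l = Suc (j + k)" by (metis add.commute less_imp_Suc_add)
          have "\<not> 1 / real (Suc (j + k)) \<le> ?d x"
            by (rule not_less_Least) (use j in \<open>simp add: l_def\<close>)
          then have "x \<in> R (j + k)" using x l j by (simp add: R_def)
          then show ?thesis by blast
        qed simp
      qed
      then have "hausdorff \<tau> (A - C) \<le> hausdorff \<tau> (D k \<union> (\<Union>i. R (i + k)))"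
        by (rule hausdorff_mono)
      also have "\<dots> \<le> hausdorff \<tau> (D k) + (\<Sum>i. hausdorff \<tau> (R (i + k)))"
        by (rule order_trans[OF hausdorff_Un_le]) (intro add_left_mono hausdorff_UN_le)
      finally have 1: "hausdorff \<tau> (A - C) \<le> hausdorff \<tau> (D k) + (\<Sum>i. hausdorff \<tau> (R (i + k)))" .
      have "hausdorff \<tau> (A \<inter> C) + hausdorff \<tau> (D k) \<le> hausdorff \<tau> ((A \<inter> C) \<union> D k)"
      proof (rule hausdorff_separated_add_le[of "1 / real (Suc k)"])
        fix a b assume "a \<in> A \<inter> C" "b \<in> D k"
        then show "1 / real (Suc k) \<le> dist a b"
          using infdist_le[of a C b] by (auto simp: D_def dist_commute)
      qed simp
      also have "\<dots> \<le> hausdorff \<tau> A"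
        by (rule hausdorff_mono) (auto simp: D_def)
      finally have 2: "hausdorff \<tau> (A \<inter> C) + hausdorff \<tau> (D k) \<le> hausdorff \<tau> A" .
      have "(\<Sum>i<k. hausdorff \<tau> (R i)) + (hausdorff \<tau> (A \<inter> C) + hausdorff \<tau> (A - C))
          \<le> (\<Sum>i<k. hausdorff \<tau> (R i)) +
            (hausdorff \<tau> (A \<inter> C) + (hausdorff \<tau> (D k) + (\<Sum>i. hausdorff \<tau> (R (i + k)))))"
        by (intro add_left_mono 1)
      also have "\<dots> = ((\<Sum>i. hausdorff \<tau> (R (i + k))) + (\<Sum>i<k. hausdorff \<tau> (R i))) +
          (hausdorff \<tau> (A \<inter> C) + hausdorff \<tau> (D k))"
        by (simp add: ac_simps)
      also have "(\<Sum>i. hausdorff \<tau> (R (i + k))) + (\<Sum>i<k. hausdorff \<tau> (R i)) = (\<Sum>i. hausdorff \<tau> (R i))"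
        by (rule suminf_offset[OF summableI, symmetric])
      finally show ?thesis
        using 2 by (meson add_left_mono order_trans)
    qed
    then have "(\<Sum>i. hausdorff \<tau> (R i)) + (hausdorff \<tau> (A \<inter> C) + hausdorff \<tau> (A - C))
        \<le> (\<Sum>i. hausdorff \<tau> (R i)) + hausdorff \<tau> A"
      by (rule ennreal_suminf_bound_add)
    with sum_fin show "hausdorff \<tau> (A \<inter> C) + hausdorff \<tau> (A - C) \<le> hausdorff \<tau> A"
      by (simp add: ennreal_add_left_cancel_le)
  qed
qed

lemma measure_space_hausdorff:
  "measure_space UNIV {A :: 'a::metric_space set. hausdorff_measurable \<tau> A} (hausdorff \<tau>)"
proof -
  interpret sigma_algebra UNIV "Pow (UNIV :: 'a set)" by (rule sigma_algebra_Pow)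
  show ?thesis
    using caratheodory_lemma[OF hausdorff_outer_measure_space[of \<tau>]]
    by (simp add: hausdorff_measurable_def)
qed

lemma hausdorff_measurable_borel:
  fixes A :: "'a::metric_space set"
  assumes "A \<in> sets borel" shows "hausdorff_measurable \<tau> A"
proof -
  interpret sigma_algebra UNIV "{A :: 'a set. hausdorff_measurable \<tau> A}"
    using measure_space_hausdorff by (auto simp: measure_space_def)
  have "sigma_sets UNIV (Collect closed) \<subseteq> {A :: 'a set. hausdorff_measurable \<tau> A}"
    by (intro sigma_sets_subset) (auto intro: hausdorff_measurable_closed)
  then show ?thesis using assms by (auto simp: borel_eq_closed)
qed

lemma hausdorff_measurable_Diff:
  fixes A :: "'a::metric_space set"
  assumes "hausdorff_measurable \<tau> A" "hausdorff_measurable \<tau> B"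
  shows "hausdorff_measurable \<tau> (A - B)"
proof -
  interpret sigma_algebra UNIV "{A :: 'a set. hausdorff_measurable \<tau> A}"
    using measure_space_hausdorff by (auto simp: measure_space_def)
  show ?thesis using assms Diff[of A B] by simp
qed

text \<open>Finite additivity on the Caratheodory sets, followed by monotonicity; it allows the
  lengths of disjoint pieces of a continuum to be added up.\<close>

lemma sum_hausdorff_le:
  fixes A :: "_ \<Rightarrow> 'a::metric_space set"
  assumes "finite I" "\<And>i. i \<in> I \<Longrightarrow> hausdorff_measurable \<tau> (A i)"
    "disjoint_family_on A I" "\<And>i. i \<in> I \<Longrightarrow> A i \<subseteq> B"
  shows "(\<Sum>i\<in>I. hausdorff \<tau> (A i)) \<le> hausdorff \<tau> B"
proof -
  interpret sigma_algebra UNIV "{A :: 'a set. hausdorff_measurable \<tau> A}"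
    using measure_space_hausdorff by (auto simp: measure_space_def)
  define M where "M = measure_of UNIV {A :: 'a set. hausdorff_measurable \<tau> A} (hausdorff \<tau>)"
  have M: "emeasure M X = hausdorff \<tau> X" "X \<in> sets M" if "hausdorff_measurable \<tau> X" for X
    unfolding M_def using that measure_space_hausdorff[of \<tau>]
    by (auto simp: measure_space_def sigma_sets_eq intro!: emeasure_measure_of_sigma sigma_algebra_axioms)
  have meas: "hausdorff_measurable \<tau> (\<Union>i\<in>I. A i)"
    using assms(1,2) finite_UN[of I A] by auto
  have "(\<Sum>i\<in>I. hausdorff \<tau> (A i)) = (\<Sum>i\<in>I. emeasure M (A i))"
    using assms(2) M by simp
  also have "\<dots> = emeasure M (\<Union>i\<in>I. A i)"
    using assms M by (intro sum_emeasure) auto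
  also have "\<dots> \<le> hausdorff \<tau> B"
    using M(1)[OF meas] assms(4) by (auto intro: hausdorff_mono)
  finally show ?thesis .
qed

subsection \<open>Chains in continua of finite length\<close>

text \<open>The function \<open>dist x\<close> is 1-Lipschitz, so it does not increase length, and
  by connectedness its values on the piece of \<open>K\<close> in the ball fill all of [0,
  r).\<close>

lemma hausdorff_1_connected_ge:
  fixes K :: "'a::metric_space set"
  assumes "connected K" "x \<in> K" "w \<in> K" "r \<le> dist x w"
  shows "ennreal r \<le> hausdorff 1 (K \<inter> ball x r)"
proof -
  have cover: "{0..<r} \<subseteq> dist x ` (K \<inter> ball x r)"
  proof
    fix v assume v: "v \<in> {0..<r}"
    have "connected (dist x ` K)"
      using assms(1) by (intro connected_continuous_image continuous_intros)
    moreover have "dist x x \<in> dist x ` K" "dist x w \<in> dist x ` K"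
      using assms by blast+
    ultimately have "v \<in> dist x ` K"
      using v assms(4) by (auto simp: connected_iff_interval)
    then show "v \<in> dist x ` (K \<inter> ball x r)"
      using v by auto
  qed
  have "ennreal r \<le> hausdorff_content 1 1 (K \<inter> ball x r)"
    unfolding hausdorff_content_def
  proof (rule INF_greatest, clarify)
    fix U :: "nat \<Rightarrow> 'a set"
    assume U: "K \<inter> ball x r \<subseteq> (\<Union>i. U i)" "\<forall>i. bounded (U i) \<and> diameter (U i) \<le> 1"
    \<comment> \<open>An interval containing the image of \<open>U i\<close>. Its length is exactly
      the weight of \<open>U i\<close>, since \<open>unit_ball_vol 1\<close> is 2 and cancels the
      halved diameter.\<close>
    define J where "J i = (if U i = {} then {}
      else {Inf (dist x ` U i) .. Inf (dist x ` U i) + diameter (U i)})" for i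
    have "dist x ` U i \<subseteq> J i" for i
    proof clarify
      fix y assume y: "y \<in> U i"
      have "Inf (dist x ` U i) \<le> dist x y"
        using y by (intro cInf_lower) (auto intro!: bdd_belowI[of _ 0])
      moreover have "dist x y - diameter (U i) \<le> Inf (dist x ` U i)"
      proof (rule cInf_greatest)
        fix v assume "v \<in> dist x ` U i"
        then obtain y' where "y' \<in> U i" "v = dist x y'" by auto
        then show "dist x y - diameter (U i) \<le> v"
          using diameter_bounded_bound[of "U i" y' y] U(2) y dist_triangle[of x y y'] by auto
      qed (use y in auto)
      ultimately show "dist x y \<in> J i" using y by (auto simp: J_def)
    qed
    then have "dist x ` (\<Union>i. U i) \<subseteq> (\<Union>i. J i)"
      unfolding image_UN by (intro UN_mono) auto
    then have "{0..<r} \<subseteq> (\<Union>i. J i)"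
      using cover image_mono[OF U(1), of "dist x"] by (meson order_trans)
    then have "emeasure lborel {0..<r} \<le> emeasure lborel (\<Union>i. J i)"
      by (intro emeasure_mono) (auto simp: J_def)
    also have "\<dots> \<le> (\<Sum>i. emeasure lborel (J i))"
      by (intro emeasure_subadditive_countably) (auto simp: J_def)
    also have "\<dots> = (\<Sum>i. hausdorff_weight 1 (U i))"
    proof (rule suminf_cong)
      show "emeasure lborel (J i) = hausdorff_weight 1 (U i)" for i
        using U(2) diameter_ge_0[of "U i"]
        by (auto simp: J_def hausdorff_weight_def unit_ball_vol_1)
    qed
    finally have "emeasure lborel {0..<r} \<le> (\<Sum>i. hausdorff_weight 1 (U i))" .
    moreover have "emeasure lborel {0..<r} = ennreal r"
      by (cases "0 \<le> r") (simp_all add: ennreal_neg)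
    ultimately show "ennreal r \<le> (\<Sum>i. hausdorff_weight 1 (U i))" by simp
  qed
  also have "\<dots> \<le> hausdorff 1 (K \<inter> ball x r)"
    by (rule hausdorff_content_le_hausdorff) simp
  finally show ?thesis .
qed

text \<open>Confines a continuum of small length to a neighbourhood of any of its points: in the
  preceding bound, \<open>r\<close> is taken to be the distance itself.\<close>

lemma connected_dist_le_hausdorff_1:
  assumes "connected K" "x \<in> K" "w \<in> K" "hausdorff 1 K \<le> ennreal L" "0 \<le> L"
  shows "dist x w \<le> L"
proof -
  have "ennreal (dist x w) \<le> hausdorff 1 (K \<inter> ball x (dist x w))"
    by (rule hausdorff_1_connected_ge[OF assms(1-3) order_refl])
  also have "\<dots> \<le> ennreal L"
    using assms(4) hausdorff_mono[of "K \<inter> ball x (dist x w)" K 1] by auto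
  finally show ?thesis using assms(5) by simp
qed

text \<open>
  A chain with the least number of points has no shortcuts, so the balls around its points with
  even (or odd) index are disjoint; each of them carries a proportional part of the length of
  \<open>K\<close>.
\<close>
lemma connected_chain:
  fixes K :: "'a::metric_space set" and d :: "'a \<Rightarrow> real"
  assumes K: "closed K" "connected K" "a \<in> K" "b \<in> K" and L: "hausdorff 1 K \<le> ennreal L" "0 \<le> L"
    and pos: "\<And>x. x \<in> K \<Longrightarrow> 0 < d x"
    and lip: "\<And>x y. \<bar>d x - d y\<bar> \<le> dist x y"
  obtains m :: nat and f where "f 0 = a" "f m = b" "\<And>i. i \<le> m \<Longrightarrow> f i \<in> K"
    "\<And>i. i < m \<Longrightarrow> dist (f i) (f (Suc i)) \<le> d (f i) / 14"
    "(\<Sum>i<m. d (f i)) \<le> 84 * L + d a"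
proof -
  \<comment> \<open>The bound is required at both ends to make \<open>R\<close> symmetric, so that
    connectedness applies to the equivalence relation it generates.\<close>
  define R where "R x y \<longleftrightarrow> x \<in> K \<and> y \<in> K \<and> dist x y \<le> d x / 14 \<and> dist x y \<le> d y / 14" for x y
  have sym: "R x y \<Longrightarrow> R y x" for x y by (auto simp: R_def dist_commute)
  have "R\<^sup>*\<^sup>* a b"
  proof (rule connected_equivalence_relation[OF K(2-4)])
    fix x y assume "R\<^sup>*\<^sup>* x y"
    then show "R\<^sup>*\<^sup>* y x" using sym by (metis sympD sympI symp_rtranclp)
  next
    fix x assume x: "x \<in> K"
    show "\<exists>T. openin (top_of_set K) T \<and> x \<in> T \<and> (\<forall>y\<in>T. R\<^sup>*\<^sup>* x y)"
    \<comment> \<open>Within d(x)/28 of x the function \<open>d\<close> stays above d(x)/2, so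
      d(x)/28 is below 1/14 of the value at either end.\<close>
    proof (intro exI[of _ "K \<inter> ball x (d x / 28)"] conjI ballI)
      show "x \<in> K \<inter> ball x (d x / 28)" using x pos[OF x] by simp
      fix y assume y: "y \<in> K \<inter> ball x (d x / 28)"
      then have "R x y"
        using x lip[of x y] pos[OF x] by (auto simp: R_def)
      then show "R\<^sup>*\<^sup>* x y" by blast
    qed (auto intro: openin_open_Int)
  qed (rule rtranclp_trans)
  then have ex: "\<exists>n. (R ^^ n) a b" by (rule rtranclp_imp_relpowp)
  define m where "m = (LEAST n. (R ^^ n) a b)"
  have least: "m \<le> n" if "(R ^^ n) a b" for n
    unfolding m_def using that by (rule Least_le)
  have "(R ^^ m) a b" unfolding m_def using ex by (rule LeastI_ex)
  then obtain f where f: "f 0 = a" "f m = b" and step: "\<And>i. i < m \<Longrightarrow> R (f i) (f (Suc i))"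
    unfolding relpowp_fun_conv by blast
  have inK: "f i \<in> K" if "i \<le> m" for i
    using that step[of "i - 1"] f(1) K(3) by (cases i) (auto simp: R_def)
  have no_shortcut: "\<not> R (f i) (f j)" if "Suc i < j" "j \<le> m" for i j
  proof
    assume *: "R (f i) (f j)"
    \<comment> \<open>Splicing out the points between \<open>i\<close> and \<open>j\<close> leaves
      \<open>i\<close> steps, the shortcut, and m - j further steps: fewer than \<open>m\<close> as
      soon as j > i + 1.\<close>
    define k where "k = Suc i + (m - j)"
    have "(R ^^ k) a b"
      unfolding relpowp_fun_conv
    proof (intro exI[of _ "\<lambda>l. if l \<le> i then f l else f (l + (j - Suc i))"] conjI allI impI)
      fix l assume l: "l < k"
      show "R (if l \<le> i then f l else f (l + (j - Suc i)))
          (if Suc l \<le> i then f (Suc l) else f (Suc l + (j - Suc i)))"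
      proof (cases "l = i")
        case True
        then show ?thesis using * that by simp
      next
        case False
        then show ?thesis
          using step[of l] step[of "l + (j - Suc i)"] l that by (auto simp: k_def)
      qed
    qed (use f that in \<open>auto simp: k_def\<close>)
    then have "m \<le> k" by (rule least)
    then show False using that by (simp add: k_def)
  qed
  \<comment> \<open>With 42 = 3 * 14 the radii are small enough that, by the Lipschitz bound on
    \<open>d\<close>, the centres of two intersecting balls are related by \<open>R\<close>; this
    would be a shortcut.\<close>
  let ?B = "\<lambda>i. ball (f i) (d (f i) / 42)"
  have close: "R x y" if "x \<in> K" "y \<in> K" "dist x c < d x / 42" "dist y c < d y / 42" for x y c
  proof -
    have "dist x y \<le> dist x c + dist y c" by (rule dist_triangle2)
    then have "dist x y \<le> d x / 14" "dist x y \<le> d y / 14"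
      using that(3,4) lip[of x y] by linarith+
    then show ?thesis using that by (simp add: R_def)
  qed
  have "(\<Sum>i<m. d (f i)) \<le> 84 * L + d a"
  \<comment> \<open>For at most one step \<open>K\<close> may lie inside the first ball and carry
    too little length; this case is the source of the summand \<open>d a\<close>.\<close>
  proof (cases "m \<le> 1")
    case True
    then have "m = 0 \<or> m = 1" by auto
    then show ?thesis using f(1) L(2) pos[OF K(3)] by auto
  next
    case False
    \<comment> \<open>A ball containing all of \<open>K\<close> would contain both ends of the chain
      and relate them directly, which is a shortcut once \<open>m\<close> is at least 2. Thus
      \<open>K\<close> leaves every ball and has length at least the radius inside it.\<close>
    have leaves: "\<exists>w\<in>K. d (f i) / 42 \<le> dist (f i) w" if "i \<le> m" for i
    proof (rule ccontr)
      assume "\<not> ?thesis"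
      then have *: "dist (f i) (f 0) < d (f i) / 42" "dist (f i) (f m) < d (f i) / 42"
        using inK by (auto simp: not_le)
      have "dist (f 0) (f m) \<le> dist (f i) (f 0) + dist (f i) (f m)"
        by (rule dist_triangle3)
      then have "dist (f 0) (f m) \<le> d (f 0) / 14" "dist (f 0) (f m) \<le> d (f m) / 14"
        using * lip[of "f i" "f 0"] lip[of "f i" "f m"] by linarith+
      then have "R (f 0) (f m)" using inK by (simp add: R_def)
      with no_shortcut[of 0 m] False show False by auto
    qed
    have length: "ennreal (d (f i) / 42) \<le> hausdorff 1 (K \<inter> ?B i)" if i: "i \<le> m" for i
      using leaves[OF i] inK[OF i] K(2) by (meson hausdorff_1_connected_ge)
    \<comment> \<open>For index sets without neighbours the balls are disjoint and the total length
      pays for their radii. The even and the odd indices contribute 42 each to the constant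
      84.\<close>
    have parity: "(\<Sum>i\<in>I. d (f i)) \<le> 42 * L"
      if I: "I \<subseteq> {..<m}" and sep: "\<And>i j. i \<in> I \<Longrightarrow> j \<in> I \<Longrightarrow> i < j \<Longrightarrow> Suc i < j" for I
    proof -
      have fin: "finite I" using I finite_subset by blast
      have disj: "?B i \<inter> ?B j = {}" if "i \<in> I" "j \<in> I" "i < j" for i j
      proof (rule ccontr)
        assume "?B i \<inter> ?B j \<noteq> {}"
        then obtain c where "dist (f i) c < d (f i) / 42" "dist (f j) c < d (f j) / 42" by auto
        then have "R (f i) (f j)" using inK I that by (intro close[of _ _ c]) force+
        then show False using no_shortcut[of i j] sep that I by force
      qed
      have "ennreal (\<Sum>i\<in>I. d (f i) / 42) = (\<Sum>i\<in>I. ennreal (d (f i) / 42))"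
        using I inK pos by (intro sum_ennreal[symmetric]) (force intro: less_imp_le)
      also have "\<dots> \<le> (\<Sum>i\<in>I. hausdorff 1 (K \<inter> ?B i))"
        using I by (intro sum_mono length) force
      also have "\<dots> \<le> hausdorff 1 K"
      proof (rule sum_hausdorff_le[OF fin])
        show "disjoint_family_on (\<lambda>i. K \<inter> ?B i) I"
          unfolding disjoint_family_on_def
        proof (intro ballI impI)
          fix i j assume "i \<in> I" "j \<in> I" "i \<noteq> j"
          then have "?B i \<inter> ?B j = {}" using disj[of i j] disj[of j i] by (cases "i < j") auto
          then show "(K \<inter> ?B i) \<inter> (K \<inter> ?B j) = {}" by blast
        qed
      qed (use K(1) in \<open>auto intro!: hausdorff_measurable_borel\<close>)
      also have "\<dots> \<le> ennreal L" by (rule L)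
      finally have "(\<Sum>i\<in>I. d (f i) / 42) \<le> L" using L(2) by simp
      then show ?thesis by (simp flip: sum_divide_distrib)
    qed
    have "(\<Sum>i<m. d (f i)) = (\<Sum>i\<in>{i\<in>{..<m}. even i}. d (f i)) + (\<Sum>i\<in>{i\<in>{..<m}. odd i}. d (f i))"
      by (subst sum.union_disjoint[symmetric]) (auto intro!: sum.cong)
    also have "\<dots> \<le> 42 * L + 42 * L"
    proof (intro add_mono parity)
      fix i j :: nat
      show "i \<in> {i\<in>{..<m}. even i} \<Longrightarrow> j \<in> {i\<in>{..<m}. even i} \<Longrightarrow> i < j \<Longrightarrow> Suc i < j"
        by (cases "j = Suc i") auto
      show "i \<in> {i\<in>{..<m}. odd i} \<Longrightarrow> j \<in> {i\<in>{..<m}. odd i} \<Longrightarrow> i < j \<Longrightarrow> Suc i < j"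
        by (cases "j = Suc i") auto
    qed auto
    finally show ?thesis using pos[OF K(3)] by simp
  qed
  then show ?thesis
    using that[of f m] f inK step by (auto simp: R_def)
qed

subsection \<open>Densities of integrals\<close>

text \<open>The integral is a supremum over simple minorants, and minorants of \<open>f\<close> and
  \<open>g\<close> add up to a minorant of the sum. This direction holds for arbitrary functions, in
  particular for the integrand of \<open>nu\<close>.\<close>

lemma nn_integral_add_ge:
  fixes f g :: "'a \<Rightarrow> ennreal"
  shows "integral\<^sup>N M f + integral\<^sup>N M g \<le> (\<integral>\<^sup>+x. f x + g x \<partial>M)"
  unfolding nn_integral_def[of M f] nn_integral_def[of M g]
proof (rule ennreal_SUP_add_SUP_le)
  fix a b assume a: "a \<in> {h. simple_function M h \<and> h \<le> f}" and b: "b \<in> {h. simple_function M h \<and> h \<le> g}"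
  then have "integral\<^sup>S M a + integral\<^sup>S M b = integral\<^sup>S M (\<lambda>x. a x + b x)"
    by (intro simple_integral_add[symmetric]) auto
  also have "\<dots> = (\<integral>\<^sup>+x. a x + b x \<partial>M)"
    using a b by (intro nn_integral_eq_simple_integral[symmetric] simple_function_add) auto
  also have "\<dots> \<le> (\<integral>\<^sup>+x. f x + g x \<partial>M)"
    using a b by (intro nn_integral_mono add_mono) (auto simp: le_fun_def)
  finally show "integral\<^sup>S M a + integral\<^sup>S M b \<le> (\<integral>\<^sup>+x. f x + g x \<partial>M)" .
qed (auto intro!: exI[of _ "\<lambda>_. 0"] simp: le_fun_def)

lemma sum_set_nn_integral_le:
  fixes f :: "'a \<Rightarrow> ennreal"
  assumes "finite I" "disjoint_family_on A I" "\<And>i. i \<in> I \<Longrightarrow> A i \<subseteq> B"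
  shows "(\<Sum>i\<in>I. \<integral>\<^sup>+x\<in>A i. f x \<partial>M) \<le> (\<integral>\<^sup>+x\<in>B. f x \<partial>M)"
proof -
  have "(\<Sum>i\<in>I. \<integral>\<^sup>+x\<in>A i. f x \<partial>M) \<le> (\<integral>\<^sup>+x\<in>(\<Union>i\<in>I. A i). f x \<partial>M)"
    using assms(1,2)
  proof (induction I)
    case (insert i I)
    have disj: "A i \<inter> (\<Union>j\<in>I. A j) = {}" "disjoint_family_on A I"
      using insert.prems insert.hyps by (auto simp: disjoint_family_on_def)
    have "(\<Sum>j\<in>insert i I. \<integral>\<^sup>+x\<in>A j. f x \<partial>M)
        \<le> (\<integral>\<^sup>+x\<in>A i. f x \<partial>M) + (\<integral>\<^sup>+x\<in>(\<Union>j\<in>I. A j). f x \<partial>M)"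
      using insert.hyps insert.IH[OF disj(2)] by (simp add: add_left_mono)
    also have "\<dots> \<le> (\<integral>\<^sup>+x. f x * indicator (A i) x + f x * indicator (\<Union>j\<in>I. A j) x \<partial>M)"
      by (rule nn_integral_add_ge)
    also have "\<dots> = (\<integral>\<^sup>+x\<in>(\<Union>j\<in>insert i I. A j). f x \<partial>M)"
      using disj(1) by (intro nn_integral_cong) (auto simp: indicator_def)
    finally show ?case .
  qed simp
  also have "\<dots> \<le> (\<integral>\<^sup>+x\<in>B. f x \<partial>M)"
    using assms(3) by (intro nn_integral_mono) (auto simp: indicator_def)
  finally show ?thesis .
qed

text \<open>Around each exceptional point there are, for every \<open>k\<close>, arbitrarily small
  balls of mass above k r^t. Vitali's lemma selects disjoint ones whose fivefold enlargements cover;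
  their total weight is at most a constant times M / k, which tends to 0. Indexing the disjoint
  families by points matches the centres that Vitali's lemma returns.\<close>

lemma hausdorff_infinite_density_null:
  fixes \<mu> :: "'a::euclidean_space set \<Rightarrow> ennreal"
  assumes "0 \<le> t" "M < \<infinity>"
    and mono: "\<And>A B. A \<subseteq> B \<Longrightarrow> \<mu> A \<le> \<mu> B"
    and super: "\<And>(I :: 'a set) A. finite I \<Longrightarrow> disjoint_family_on A I \<Longrightarrow> (\<Sum>i\<in>I. \<mu> (A i)) \<le> M"
  shows "hausdorff t {z. \<not> (\<exists>k r0. 0 < r0 \<and> (\<forall>r. 0 < r \<and> r \<le> r0 \<longrightarrow> \<mu> (ball z r) \<le> ennreal (k * r powr t)))} = 0"
    (is "hausdorff t ?N = 0")
proof -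
  define N where "N = ?N"
  \<comment> \<open>Weight of a ball of radius 5 r in units of r^t, the 5 being the Vitali
    enlargement; for \<open>t = 0\<close> both the weight and r^t equal 1.\<close>
  define c where "c = (if t = 0 then 1 else unit_ball_vol t * 5 powr t)"
  have "0 \<le> c" using assms(1) by (auto simp: c_def)
  have weight: "hausdorff_weight t (cball z (5 * r)) \<le> ennreal (c * r powr t)" if "0 < r" for z :: 'a and r
    using that assms(1) by (auto simp: hausdorff_weight_def c_def powr_mult mult.assoc)
  have "hausdorff_content t \<delta> N = 0" if "0 < \<delta>" for \<delta>
  proof -
    have le: "hausdorff_content t \<delta> N \<le> ennreal (c / k) * M" if "0 < k" for k
    proof -
      \<comment> \<open>Radius at most \<delta> / 10, so that the fivefold balls have diameter at
        most \<open>\<delta>\<close>.\<close>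
      have "\<exists>r. 0 < r \<and> r \<le> \<delta> / 10 \<and> ennreal (k * r powr t) < \<mu> (ball z r)" if "z \<in> N" for z
      proof -
        have "\<not> (0 < \<delta> / 10 \<and> (\<forall>r. 0 < r \<and> r \<le> \<delta> / 10 \<longrightarrow> \<mu> (ball z r) \<le> ennreal (k * r powr t)))"
          using that unfolding N_def by blast
        then show ?thesis using \<open>0 < \<delta>\<close> by (auto simp: not_le)
      qed
      then obtain r where r: "\<And>z. z \<in> N \<Longrightarrow> 0 < r z \<and> r z \<le> \<delta> / 10"
          "\<And>z. z \<in> N \<Longrightarrow> ennreal (k * r z powr t) < \<mu> (ball z (r z))"
        by metis
      obtain C where C: "countable C" "C \<subseteq> N"
          "pairwise (\<lambda>i j. disjnt (cball i (r i)) (cball j (r j))) C"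
          "N \<subseteq> (\<Union>i\<in>C. cball i (5 * r i))"
        by (rule Vitali_covering_lemma_cballs[where S=N and K=N and a="\<lambda>z. z" and r=r and B="\<delta>/10"]) (use r(1) in force)+
      show ?thesis
      proof (rule hausdorff_content_countable_le[OF C(1,4)])
        fix F assume F: "finite F" "F \<subseteq> C"
        have "(\<Sum>z\<in>F. hausdorff_weight t (cball z (5 * r z))) \<le> (\<Sum>z\<in>F. ennreal (c / k) * \<mu> (cball z (r z)))"
        proof (rule sum_mono)
          fix z assume "z \<in> F"
          then have z: "z \<in> N" using F C(2) by blast
          have "hausdorff_weight t (cball z (5 * r z)) \<le> ennreal (c * r z powr t)"
            using r(1)[OF z] by (intro weight) auto
          also have "\<dots> = ennreal (c / k) * ennreal (k * r z powr t)"
            using \<open>0 < k\<close> \<open>0 \<le> c\<close> by (simp flip: ennreal_mult)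
          also have "\<dots> \<le> ennreal (c / k) * \<mu> (cball z (r z))"
            using r(2)[OF z] mono[OF ball_subset_cball[of z "r z"]] by (intro mult_left_mono) auto
          finally show "hausdorff_weight t (cball z (5 * r z)) \<le> ennreal (c / k) * \<mu> (cball z (r z))" .
        qed
        also have "\<dots> = ennreal (c / k) * (\<Sum>z\<in>F. \<mu> (cball z (r z)))"
          by (simp add: sum_distrib_left)
        also have "\<dots> \<le> ennreal (c / k) * M"
          using F C(3) by (intro mult_left_mono super)
            (auto simp: disjoint_family_on_def pairwise_def disjnt_def)
        finally show "(\<Sum>z\<in>F. hausdorff_weight t (cball z (5 * r z))) \<le> ennreal (c / k) * M" .
      qed (use r(1) C(2) \<open>0 < \<delta>\<close> in \<open>fastforce+\<close>)
    qed
    obtain m where m: "M = ennreal m" "0 \<le> m"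
      using assms(2) by (cases M) auto
    have "hausdorff_content t \<delta> N \<le> 0"
    proof (rule ennreal_le_epsilon)
      fix e :: real assume "0 < e"
      \<comment> \<open>Gives c m / k \<le> e; the summand 1 keeps \<open>k\<close> positive when c
        m vanishes.\<close>
      define k where "k = (c * m + 1) / e"
      have "0 < k" using \<open>0 \<le> c\<close> m(2) \<open>0 < e\<close> by (auto simp: k_def intro!: divide_pos_pos add_nonneg_pos)
      have "c / k * m \<le> e"
        using \<open>0 < k\<close> \<open>0 < e\<close> \<open>0 \<le> c\<close> m(2) by (simp add: k_def field_simps)
      then have "ennreal (c / k) * M \<le> ennreal e"
        using m \<open>0 \<le> c\<close> \<open>0 < k\<close> by (simp add: m(1) ennreal_leI flip: ennreal_mult)
      then show "hausdorff_content t \<delta> N \<le> 0 + ennreal e"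
        using le[OF \<open>0 < k\<close>] by (simp add: order_trans)
    qed
    then show ?thesis by simp
  qed
  then have "hausdorff t N = (SUP \<delta>\<in>{0::real<..}. 0)"
    unfolding hausdorff_def by (intro SUP_cong) auto
  then show ?thesis by (simp add: SUP_constant N_def)
qed

subsection \<open>Oscillation of the averages over one step\<close>

lemma bdist_lipschitz: "\<bar>bdist \<Omega> x - bdist \<Omega> y\<bar> \<le> dist x y"
  unfolding bdist_def by (rule infdist_triangle_abs)

lemma bdist_le_dist: "z \<in> frontier \<Omega> \<Longrightarrow> bdist \<Omega> x \<le> dist z x"
  unfolding bdist_def by (metis dist_commute infdist_le)

lemma bdist_pos:
  assumes "open \<Omega>" "x \<in> \<Omega>" "frontier \<Omega> \<noteq> {}"
  shows "0 < bdist \<Omega> x"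
proof -
  have "x \<notin> frontier \<Omega>" using assms(1,2) by (simp add: frontier_def interior_open)
  then show ?thesis
    unfolding bdist_def using assms(3)
    by (metis frontier_closed in_closed_iff_infdist_zero infdist_nonneg order_le_less)
qed

text \<open>A ball that leaves \<Omega> is a connected set meeting \<Omega> and its complement,
  hence it meets the frontier, closer to the centre than \<open>bdist\<close> allows.\<close>

lemma ball_bdist_subset:
  assumes "open \<Omega>" "x \<in> \<Omega>" "r \<le> bdist \<Omega> x"
  shows "ball x r \<subseteq> \<Omega>"
proof (cases "0 < r")
  case True
  show ?thesis
  proof (rule ccontr)
    assume "\<not> ?thesis"
    then have "ball x r \<inter> frontier \<Omega> \<noteq> {}"
      using True assms(2) centre_in_ball[of x r]
      by (intro connected_Int_frontier) (blast intro: convex_connected convex_ball)+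
    then obtain z where "z \<in> frontier \<Omega>" "dist x z < r" by auto
    then show False using bdist_le_dist[of z \<Omega> x] assms(3) by (simp add: dist_commute)
  qed
qed (simp add: ball_empty)

lemma set_integrable_of_lebesgue_on:
  assumes "integrable (lebesgue_on \<Omega>) u" "open \<Omega>" "A \<subseteq> \<Omega>" "A \<in> sets lebesgue"
  shows "set_integrable lebesgue A (u :: 'a::euclidean_space \<Rightarrow> real)"
proof -
  have "set_integrable lebesgue \<Omega> u"
    using assms(1,2) by (simp add: set_integrable_def integrable_restrict_space)
  then show ?thesis using assms(4,3) by (rule set_integrable_subset)
qed

lemma set_integrable_lmeasurable_const:
  "S \<in> lmeasurable \<Longrightarrow> set_integrable lebesgue S (\<lambda>_. c :: real)"
  unfolding set_integrable_def
  by (simp add: lmeasurable_iff_integrable)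

lemma abs_average_diff_le:
  fixes f :: "'a::euclidean_space \<Rightarrow> real"
  assumes S: "S \<in> lmeasurable" "0 < measure lebesgue S" and f: "set_integrable lebesgue S f"
  shows "\<bar>1 / measure lebesgue S * (LINT v:S|lebesgue. f v) - c\<bar>
    \<le> 1 / measure lebesgue S * (LINT v:S|lebesgue. \<bar>f v - c\<bar>)"
proof -
  have fc: "set_integrable lebesgue S (\<lambda>v. f v - c)"
    using f set_integrable_lmeasurable_const[OF S(1)] by (rule set_integral_diff)
  have "(LINT v:S|lebesgue. f v - c) = (LINT v:S|lebesgue. f v) - (LINT v:S|lebesgue. c)"
    using f set_integrable_lmeasurable_const[OF S(1)] by (rule set_integral_diff)
  also have "(LINT v:S|lebesgue. c) = measure lebesgue S * c"
    unfolding set_lebesgue_integral_def using S(1) by (simp add: lmeasurable_iff_integrable)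
  finally have "1 / measure lebesgue S * (LINT v:S|lebesgue. f v) - c
      = 1 / measure lebesgue S * (LINT v:S|lebesgue. f v - c)"
    using S(2) by (simp add: field_simps)
  moreover have "\<bar>LINT v:S|lebesgue. f v - c\<bar> \<le> (LINT v:S|lebesgue. \<bar>f v - c\<bar>)"
    using set_integral_norm_bound[OF fc] by simp
  ultimately show ?thesis
    using S(2) by (simp add: abs_mult divide_right_mono)
qed

text \<open>
  A substitute for Jensen's inequality that needs no measurability of \<open>F\<close>: values of
  \<open>\<bar>f - c\<bar>\<close> below half of its average contribute at most half of that average.
\<close>
lemma abs_average_diff_le_powr:
  fixes f :: "'a::euclidean_space \<Rightarrow> real"
  assumes S: "S \<in> lmeasurable" "0 < measure lebesgue S" and f: "set_integrable lebesgue S f"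
    and le: "\<And>w. w \<in> S \<Longrightarrow> \<bar>f w - c\<bar> \<le> A * F w"
    and A: "0 < A" and p: "1 \<le> p" and N: "0 \<le> N"
    and int: "(\<integral>\<^sup>+w. ennreal (F w powr p) * indicator S w \<partial>lebesgue) \<le> ennreal N"
  shows "\<bar>1 / measure lebesgue S * (LINT v:S|lebesgue. f v) - c\<bar>
    \<le> 2 * A * (N / measure lebesgue S) powr (1 / p)"
proof -
  define V where "V = measure lebesgue S"
  define a where "a = \<bar>1 / V * (LINT v:S|lebesgue. f v) - c\<bar>"
  have V: "0 < V" using S(2) by (simp add: V_def)
  show ?thesis
  proof (cases "a = 0")
    case True
    then show ?thesis using A by (simp add: a_def V_def)
  next
    case False
    then have a: "0 < a" by (simp add: a_def)
    \<comment> \<open>Slope of a linear minorant: if b = |f w - c| exceeds a/2, then (a/2)^(p-1) b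
      \<le> b^p \<le> A^p F(w)^p. As |f - c| has average at least \<open>a\<close>, its excess over
      a/2 integrates to at least V a/2, whence the factor 2 in the conclusion.\<close>
    define k where "k = (a / 2) powr (p - 1) / A powr p"
    have k: "0 < k" using a A by (simp add: k_def)
    have fc: "set_integrable lebesgue S (\<lambda>v. \<bar>f v - c\<bar>)"
      using f set_integrable_lmeasurable_const[OF S(1)] by (intro set_integrable_abs set_integral_diff)
    have pt: "k * (\<bar>f w - c\<bar> - a / 2) \<le> F w powr p" if "w \<in> S" for w
    proof (cases "\<bar>f w - c\<bar> \<le> a / 2")
      case True
      then have "k * (\<bar>f w - c\<bar> - a / 2) \<le> 0" using k by (intro mult_nonneg_nonpos) auto
      then show ?thesis by (rule order_trans) simp
    next
      case False
      define b where "b = \<bar>f w - c\<bar>"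
      have b: "a / 2 < b" "0 < b" using False a by (auto simp: b_def)
      have "k * (b - a / 2) \<le> k * b" using k a by (intro mult_left_mono) auto
      also have "\<dots> \<le> b powr (p - 1) / A powr p * b"
        using a b p A unfolding k_def by (intro mult_right_mono divide_right_mono powr_mono2) auto
      also have "\<dots> = (b / A) powr p"
        using b A by (simp add: powr_divide powr_diff)
      also have "\<dots> \<le> F w powr p"
        using b A p le[OF that] by (intro powr_mono2) (auto simp: b_def field_simps)
      finally show ?thesis by (simp add: b_def)
    qed
    have "V * a \<le> (LINT v:S|lebesgue. \<bar>f v - c\<bar>)"
      using abs_average_diff_le[OF S f, of c] V by (simp add: a_def V_def field_simps)
    have half: "(LINT v:S|lebesgue. a / 2) = V * (a / 2)"
      unfolding set_lebesgue_integral_def V_def using S(1) by (simp add: lmeasurable_iff_integrable)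
    have "k * (V * a - V * (a / 2)) \<le> k * ((LINT v:S|lebesgue. \<bar>f v - c\<bar>) - V * (a / 2))"
      using k \<open>V * a \<le> _\<close> by (intro mult_left_mono) auto
    also have "k * ((LINT v:S|lebesgue. \<bar>f v - c\<bar>) - V * (a / 2))
        = (LINT v:S|lebesgue. k * (\<bar>f v - c\<bar> - a / 2))"
      by (simp only: set_integral_mult_right half set_integral_diff(2)[OF fc set_integrable_lmeasurable_const[OF S(1)]])
    also have "\<dots> \<le> N"
      unfolding set_lebesgue_integral_def
    proof (rule integral_real_bounded[OF N])
      have "(\<integral>\<^sup>+v. ennreal (indicator S v *\<^sub>R (k * (\<bar>f v - c\<bar> - a / 2))) \<partial>lebesgue)
          \<le> (\<integral>\<^sup>+w. ennreal (F w powr p) * indicator S w \<partial>lebesgue)"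
        using pt by (intro nn_integral_mono) (auto simp: indicator_def intro!: ennreal_leI)
      with int show "(\<integral>\<^sup>+v. ennreal (indicator S v *\<^sub>R (k * (\<bar>f v - c\<bar> - a / 2))) \<partial>lebesgue) \<le> ennreal N"
        by (rule order_trans[rotated])
    qed
    finally have "k * (V * (a / 2)) \<le> N" by (simp add: algebra_simps)
    moreover have "k * (V * (a / 2)) = (a / 2) powr p * V / A powr p"
      using a by (simp add: k_def powr_diff)
    ultimately have "(a / 2) powr p * V / A powr p \<le> N" by (simp only:)
    then have "(a / 2) powr p \<le> A powr p * (N / V)"
      using V A by (simp add: field_simps)
    then have "((a / 2) powr p) powr (1 / p) \<le> (A powr p * (N / V)) powr (1 / p)"
      using p by (intro powr_mono2) auto
    also have "\<dots> = A * (N / V) powr (1 / p)"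
      using A N V p by (subst powr_mult) (auto simp: powr_powr)
    finally show ?thesis
      using a p by (simp add: powr_powr a_def V_def)
  qed
qed

text \<open>Enlarging the domain of averaging from \<Phi>(y) to \<Psi>(w) costs the ratio of the
  volumes, at most 4^n because d(w) and d(y) are comparable. The weight d(w)^s(w) is inserted and
  compensated to exhibit the integrand of \<open>nu\<close> at \<open>w\<close>.\<close>

lemma abs_diff_gmean_le:
  fixes \<Omega> :: "'a::euclidean_space set"
  assumes \<Omega>: "open \<Omega>" "frontier \<Omega> \<noteq> {}" and u: "integrable (lebesgue_on \<Omega>) u"
    and x: "x \<in> \<Omega>" "y \<in> \<Omega>" "dist x y \<le> bdist \<Omega> x / 14" and w: "w \<in> Phi \<Omega> x"
  shows "\<bar>u w - gmean \<Omega> y u\<bar> \<le> 4 ^ DIM('a) * bdist \<Omega> w powr s w *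
    (1 / measure lebesgue (Psi \<Omega> w) *
      (LINT v:Psi \<Omega> w|lebesgue. \<bar>u v - u w\<bar> / bdist \<Omega> w powr s w))"
proof -
  let ?d = "bdist \<Omega>"
  have dx: "0 < ?d x" "0 < ?d y" using \<Omega> x by (auto intro: bdist_pos)
  have wx: "dist x w < ?d x / 6" using w by (simp add: Phi_def)
  have "w \<in> \<Omega>"
    using ball_bdist_subset[OF \<Omega>(1) x(1), of "?d x / 6"] w dx by (auto simp: Phi_def)
  then have dw: "0 < ?d w" using \<Omega> by (auto intro: bdist_pos)
  have lip: "\<bar>?d x - ?d w\<bar> \<le> dist x w" "\<bar>?d x - ?d y\<bar> \<le> dist x y"
    by (rule bdist_lipschitz)+
  have sub: "Phi \<Omega> y \<subseteq> Psi \<Omega> w"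
  proof
    fix v assume "v \<in> Phi \<Omega> y"
    then have "dist y v < ?d y / 6" by (simp add: Phi_def)
    moreover have "dist w v \<le> dist w x + dist x y + dist y v"
      using dist_triangle[of w v x] dist_triangle[of x v y] by linarith
    \<comment> \<open>Since d(y) \<le> 15/14 d(x), dist w v is less than (1/6 + 1/14 + 15/84) d(x) =
      5/12 d(x), while d(w)/2 exceeds 5/12 d(x). The step size 1/14 is the largest for which this
      computation closes.\<close>
    ultimately have "dist w v < ?d w / 2"
      using lip wx x(3) dx by (simp add: dist_commute)
    then show "v \<in> Psi \<Omega> w" by (simp add: Psi_def)
  qed
  have meas: "measure lebesgue (Phi \<Omega> y) = unit_ball_vol (real DIM('a)) * (?d y / 6) ^ DIM('a)"
    "measure lebesgue (Psi \<Omega> w) = unit_ball_vol (real DIM('a)) * (?d w / 2) ^ DIM('a)"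
    using dx dw by (simp_all add: Phi_def Psi_def content_ball)
  have pos: "0 < measure lebesgue (Phi \<Omega> y)" "0 < measure lebesgue (Psi \<Omega> w)"
    unfolding meas using dx dw by simp_all
  \<comment> \<open>Here d(w) \<le> 7/6 d(x) and d(y) \<ge> 13/14 d(x).\<close>
  have "(?d w / 2) ^ DIM('a) \<le> (4 * (?d y / 6)) ^ DIM('a)"
    using lip wx x(3) dx dw by (intro power_mono) auto
  then have ratio: "measure lebesgue (Psi \<Omega> w) \<le> 4 ^ DIM('a) * measure lebesgue (Phi \<Omega> y)"
    unfolding meas power_mult_distrib by (simp add: mult.left_commute mult_left_mono)
  have "Psi \<Omega> w \<subseteq> \<Omega>"
    unfolding Psi_def using dw \<open>w \<in> \<Omega>\<close> by (intro ball_bdist_subset[OF \<Omega>(1)]) auto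
  have lm: "Phi \<Omega> y \<in> lmeasurable" "Psi \<Omega> w \<in> lmeasurable"
    by (simp_all add: Phi_def Psi_def)
  have int: "set_integrable lebesgue (Phi \<Omega> y) u" "set_integrable lebesgue (Psi \<Omega> w) u"
    using sub \<open>Psi \<Omega> w \<subseteq> \<Omega>\<close> lm by (auto intro!: set_integrable_of_lebesgue_on[OF u \<Omega>(1)])
  have int': "set_integrable lebesgue (Psi \<Omega> w) (\<lambda>v. \<bar>u v - u w\<bar>)"
    using int(2) set_integrable_lmeasurable_const[OF lm(2)]
    by (intro set_integrable_abs set_integral_diff)
  define I where "I = (LINT v:Psi \<Omega> w|lebesgue. \<bar>u v - u w\<bar>)"
  have "0 \<le> I" unfolding I_def set_lebesgue_integral_def by (intro Bochner_Integration.integral_nonneg) auto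
  have "(LINT v:Phi \<Omega> y|lebesgue. \<bar>u v - u w\<bar>) \<le> I"
    unfolding I_def set_lebesgue_integral_def
  proof (rule integral_mono)
    show "integrable lebesgue (\<lambda>v. indicator (Psi \<Omega> w) v *\<^sub>R \<bar>u v - u w\<bar>)"
      using int' by (simp add: set_integrable_def)
    have "set_integrable lebesgue (Phi \<Omega> y) (\<lambda>v. \<bar>u v - u w\<bar>)"
      using int' sub lm by (auto intro: set_integrable_subset)
    then show "integrable lebesgue (\<lambda>v. indicator (Phi \<Omega> y) v *\<^sub>R \<bar>u v - u w\<bar>)"
      by (simp add: set_integrable_def)
  qed (use sub in \<open>auto simp: indicator_def\<close>)
  then have "\<bar>gmean \<Omega> y u - u w\<bar> \<le> 1 / measure lebesgue (Phi \<Omega> y) * I"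
    using abs_average_diff_le[OF lm(1) pos(1) int(1), of "u w"] pos(1)
    unfolding gmean_def by (meson less_imp_le mult_left_mono order_trans zero_le_divide_1_iff)
  also have "\<dots> \<le> 4 ^ DIM('a) * (1 / measure lebesgue (Psi \<Omega> w)) * I"
    using ratio pos \<open>0 \<le> I\<close> by (intro mult_right_mono) (auto simp: field_simps)
  also have "\<dots> = 4 ^ DIM('a) * ?d w powr s w * (1 / measure lebesgue (Psi \<Omega> w) *
      (LINT v:Psi \<Omega> w|lebesgue. \<bar>u v - u w\<bar> / ?d w powr s w))"
    using dw by (simp add: I_def)
  finally show ?thesis by (simp add: abs_minus_commute)
qed

text \<open>The averaging estimate on \<Phi>(x), with the constant taken to be the average at
  \<open>y\<close>. The volume of \<Phi>(x) is proportional to d(x)^n and produces the exponent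
  -n/p.\<close>

lemma gmean_step:
  fixes \<Omega> :: "'a::euclidean_space set"
  assumes \<Omega>: "open \<Omega>" "frontier \<Omega> \<noteq> {}" and u: "integrable (lebesgue_on \<Omega>) u"
    and p: "1 \<le> p" and \<sigma>: "0 \<le> \<sigma>"
    and x: "x \<in> \<Omega>" "y \<in> \<Omega>" "dist x y \<le> bdist \<Omega> x / 14"
    and s: "\<And>w. w \<in> Phi \<Omega> x \<Longrightarrow> \<sigma> \<le> s w" and d: "\<And>w. w \<in> Phi \<Omega> x \<Longrightarrow> bdist \<Omega> w \<le> 1"
    and N: "0 \<le> N" "nu \<Omega> s p (Phi \<Omega> x) u \<le> ennreal N"
  shows "\<bar>gmean \<Omega> x u - gmean \<Omega> y u\<bar> \<le>
    2 * (4 ^ DIM('a) * 2 powr \<sigma>) * (unit_ball_vol (real DIM('a)) / 6 ^ DIM('a)) powr (- 1 / p) *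
    bdist \<Omega> x powr (\<sigma> - real DIM('a) / p) * N powr (1 / p)"
proof -
  let ?d = "bdist \<Omega>"
  let ?F = "\<lambda>w. 1 / measure lebesgue (Psi \<Omega> w) *
      (LINT v:Psi \<Omega> w|lebesgue. \<bar>u v - u w\<bar> / ?d w powr s w)"
  let ?A = "4 ^ DIM('a) * (2 powr \<sigma> * ?d x powr \<sigma>)"
  have dx: "0 < ?d x" using \<Omega> x by (auto intro: bdist_pos)
  have sub: "Phi \<Omega> x \<subseteq> \<Omega>"
    using ball_bdist_subset[OF \<Omega>(1) x(1), of "?d x / 6"] dx by (auto simp: Phi_def)
  have V: "measure lebesgue (Phi \<Omega> x) = unit_ball_vol (real DIM('a)) / 6 ^ DIM('a) * ?d x ^ DIM('a)"
    using dx by (simp add: Phi_def content_ball power_divide)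
  have lm: "Phi \<Omega> x \<in> lmeasurable" by (simp add: Phi_def)
  have "\<bar>gmean \<Omega> x u - gmean \<Omega> y u\<bar> \<le> 2 * ?A * (N / measure lebesgue (Phi \<Omega> x)) powr (1 / p)"
    unfolding gmean_def[of \<Omega> x]
  proof (rule abs_average_diff_le_powr)
    show "set_integrable lebesgue (Phi \<Omega> x) u"
      using sub lm by (intro set_integrable_of_lebesgue_on[OF u \<Omega>(1)]) auto
    show "0 < measure lebesgue (Phi \<Omega> x)" "0 < ?A" using dx by (simp_all add: V)
    show "(\<integral>\<^sup>+w. ennreal (?F w powr p) * indicator (Phi \<Omega> x) w \<partial>lebesgue) \<le> ennreal N"
      using N(2) sub by (simp add: nu_def Int_absorb1)
    fix w assume w: "w \<in> Phi \<Omega> x"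
    have F: "0 \<le> ?F w"
      unfolding set_lebesgue_integral_def by (intro mult_nonneg_nonneg Bochner_Integration.integral_nonneg) auto
    have dw: "0 < ?d w" using \<Omega> w sub by (auto intro: bdist_pos)
    have "?d w \<le> 2 * ?d x"
      using bdist_lipschitz[of \<Omega> x w] w dx by (simp add: Phi_def)
    \<comment> \<open>A base of at most 1 reverses the order of exponents, so a lower bound on
      \<open>s\<close> is what is wanted.\<close>
    have "?d w powr s w \<le> ?d w powr \<sigma>"
      using dw d[OF w] s[OF w] by (intro powr_mono') auto
    also have "\<dots> \<le> (2 * ?d x) powr \<sigma>"
      using dw \<sigma> \<open>?d w \<le> 2 * ?d x\<close> by (intro powr_mono2) auto
    also have "\<dots> = 2 powr \<sigma> * ?d x powr \<sigma>" using dx by (simp add: powr_mult)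
    finally have "4 ^ DIM('a) * ?d w powr s w * ?F w \<le> ?A * ?F w"
      using F by (intro mult_right_mono mult_left_mono) auto
    then show "\<bar>u w - gmean \<Omega> y u\<bar> \<le> ?A * ?F w"
      using abs_diff_gmean_le[OF \<Omega> u x w, of s] by (rule order_trans[rotated])
  qed (use lm p N in auto)
  also have "(N / measure lebesgue (Phi \<Omega> x)) powr (1 / p)
      = N powr (1 / p) * ((unit_ball_vol (real DIM('a)) / 6 ^ DIM('a)) powr (- 1 / p) *
        ?d x powr (- real DIM('a) / p))"
  proof -
    have "?d x ^ DIM('a) = ?d x powr real DIM('a)"
      using dx by (simp add: powr_realpow)
    then show ?thesis
      using dx N(1) by (simp add: V powr_divide powr_mult powr_powr powr_minus_divide)
  qed
  also have "2 * ?A * (N powr (1 / p) * ((unit_ball_vol (real DIM('a)) / 6 ^ DIM('a)) powr (- 1 / p) *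
        ?d x powr (- real DIM('a) / p)))
      = 2 * (4 ^ DIM('a) * 2 powr \<sigma>) * (unit_ball_vol (real DIM('a)) / 6 ^ DIM('a)) powr (- 1 / p) *
        (?d x powr \<sigma> * ?d x powr (- real DIM('a) / p)) * N powr (1 / p)"
    by (simp add: ac_simps)
  also have "?d x powr \<sigma> * ?d x powr (- real DIM('a) / p) = ?d x powr (\<sigma> - real DIM('a) / p)"
    using dx by (simp flip: powr_add)
  finally show ?thesis .
qed

subsection \<open>Traces at a boundary point\<close>

text \<open>The right-hand side is \<open>p\<close> times the exponent that the chain argument
  yields, apart from t/p. With q = p \<sigma> - n there is equality for q \<le> p - 1; the surplus
  is (\<theta> - 1) (q - (p - 1)) up to q = p and \<theta> - 1 beyond.\<close>

lemma alpha_exp_le: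
  fixes n p \<sigma> \<theta> :: real
  assumes "1 \<le> p" "1 \<le> \<theta>"
  defines "e \<equiv> \<sigma> - n / p - 1"
  shows "alpha_exp n p \<sigma> \<theta> \<le> p * (1 + (if e \<le> 0 then \<theta> * e else e))"
proof -
  define q where "q = p * \<sigma> - n"
  have pe: "p * e = q - p" using assms(1) by (simp add: e_def q_def field_simps)
  then have sgn: "e \<le> 0 \<longleftrightarrow> q \<le> p"
    using assms(1) mult_le_0_iff[of p e] by auto
  have eq: "p * (1 + \<theta> * e) = p + \<theta> * (q - p)" "p * (1 + e) = q"
    unfolding pe[symmetric] using pe by (simp_all add: algebra_simps)
  have \<alpha>: "alpha_exp n p \<sigma> \<theta> = (if q \<le> p - 1 then p * (1 - \<theta>) + q * \<theta> else 1 - \<theta> + q)"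
    by (simp add: alpha_exp_def q_def)
  \<comment> \<open>\<open>alpha_exp\<close> changes branch at q = p - 1, but \<open>e\<close>
    changes sign only at q = p.\<close>
  consider "q \<le> p - 1" | "p - 1 < q" "q \<le> p" | "p < q" by linarith
  then show ?thesis
  proof cases
    case 1
    then have "e \<le> 0" using sgn by simp
    then show ?thesis using 1 eq(1) \<alpha> by (simp only: if_True) (simp add: algebra_simps)
  next
    case 2
    have "0 \<le> (\<theta> - 1) * (q - (p - 1))" using 2 assms(2) by (intro mult_nonneg_nonneg) auto
    also have "\<dots> = (p + \<theta> * (q - p)) - (1 - \<theta> + q)" by (simp add: algebra_simps)
    finally have "1 - \<theta> + q \<le> p * (1 + \<theta> * e)" using eq(1) by linarith
    then show ?thesis using 2 sgn \<alpha> by simp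
  next
    case 3
    then show ?thesis using sgn \<alpha> eq(2) assms(2) by simp
  qed
qed

text \<open>Both branches are nondecreasing in \<sigma>, and they agree at the threshold, with
  common value p - \<theta>.\<close>

lemma alpha_exp_mono:
  assumes "0 < p" "1 \<le> \<theta>" "\<sigma> \<le> \<sigma>'"
  shows "alpha_exp n p \<sigma> \<theta> \<le> alpha_exp n p \<sigma>' \<theta>"
proof -
  define q q' where "q = p * \<sigma> - n" and "q' = p * \<sigma>' - n"
  have "q \<le> q'" using assms by (simp add: q_def q'_def)
  then have "q * \<theta> \<le> q' * \<theta>" using assms(2) by (intro mult_right_mono) auto
  moreover have "q * \<theta> \<le> (p - 1) * \<theta>" if "q \<le> p - 1"
    using that assms(2) by (intro mult_right_mono) auto
  ultimately show ?thesis
    using \<open>q \<le> q'\<close> unfolding alpha_exp_def q_def[symmetric] q'_def[symmetric]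
    by (auto simp: algebra_simps)
qed

lemma frontier_ball_nonempty:
  fixes z :: "'a::metric_space"
  assumes "z \<in> frontier \<Omega>" "0 < \<delta>"
  shows "\<Omega> \<inter> ball z \<delta> \<noteq> {}"
proof -
  have "z \<in> closure \<Omega>" using assms(1) by (simp add: frontier_def)
  then obtain y where "y \<in> \<Omega>" "dist y z < \<delta>" using assms(2) closure_approachable by blast
  then have "y \<in> \<Omega> \<inter> ball z \<delta>" by (simp add: dist_commute)
  then show ?thesis by blast
qed

text \<open>Shrinking the ball raises the infimum of \<open>s\<close>, so \<open>alpha_lower\<close>
  increases as \<delta> decreases and its limit is a supremum. Any smaller number is exceeded at
  some fixed radius; radius at most 1 later ensures \<open>bdist\<close> at most 1.\<close>

lemma alpha_lower_gt:
  fixes \<Omega> :: "'a::euclidean_space set"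
  assumes p: "0 < p" and \<theta>: "1 \<le> \<theta> z" and z: "z \<in> frontier \<Omega>" and s: "bounded (s ` \<Omega>)"
    and c: "c < alpha_zero \<Omega> s p \<theta> z"
  shows "\<exists>\<delta>. 0 < \<delta> \<and> \<delta> \<le> 1 \<and> c < alpha_lower \<Omega> s p \<theta> \<delta> z"
proof -
  let ?a = "\<lambda>\<delta>. alpha_lower \<Omega> s p \<theta> \<delta> z"
  obtain m where m: "\<And>x. x \<in> \<Omega> \<Longrightarrow> \<bar>s x\<bar> \<le> m"
    using s by (auto simp: bounded_iff)
  have bdd: "bdd_below (s ` (\<Omega> \<inter> ball z \<delta>))" for \<delta>
    using m by (intro bdd_belowI2[of _ "- m"]) (auto simp: abs_le_iff minus_le_iff)
  have le: "s_lower \<Omega> s \<delta> z \<le> m" if "0 < \<delta>" for \<delta>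
  proof -
    obtain x where "x \<in> \<Omega> \<inter> ball z \<delta>" using frontier_ball_nonempty[OF z \<open>0 < \<delta>\<close>] by blast
    then show ?thesis
      unfolding s_lower_def using m[of x] by (intro cINF_lower2[OF bdd]) auto
  qed
  have anti: "?a \<delta>' \<le> ?a \<delta>" if "0 < \<delta>" "\<delta> \<le> \<delta>'" for \<delta> \<delta>'
    unfolding alpha_lower_def
  proof (rule alpha_exp_mono[where \<theta> = "\<theta> z", OF p \<theta>])
    show "s_lower \<Omega> s \<delta>' z \<le> s_lower \<Omega> s \<delta> z"
      unfolding s_lower_def
      using frontier_ball_nonempty[OF z \<open>0 < \<delta>\<close>] that by (intro cINF_superset_mono bdd) auto
  qed
  define A where "A = (SUP \<delta>\<in>{0<..1::real}. ?a \<delta>)"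
  have bddA: "bdd_above (?a ` {0<..1})"
    unfolding alpha_lower_def
    by (intro bdd_aboveI2[where M = "alpha_exp (real DIM('a)) p m (\<theta> z)"] alpha_exp_mono p \<theta> le) auto
  have upper: "?a \<delta> \<le> A" if "0 < \<delta>" "\<delta> \<le> 1" for \<delta>
    unfolding A_def using that by (intro cSUP_upper bddA) auto
  have less: "\<exists>\<delta>. 0 < \<delta> \<and> \<delta> \<le> 1 \<and> a < ?a \<delta>" if "a < A" for a
    using that unfolding A_def by (subst (asm) less_cSUP_iff[OF _ bddA]) auto
  have "(?a \<longlongrightarrow> A) (at_right 0)"
  proof (rule order_tendstoI)
    fix a assume "a < A"
    then obtain \<delta> where \<delta>: "0 < \<delta>" "\<delta> \<le> 1" "a < ?a \<delta>" using less by blast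
    then show "\<forall>\<^sub>F x in at_right 0. a < ?a x"
      unfolding eventually_at_right_field using anti by (intro exI[of _ \<delta>]) (force intro: less_le_trans)
  next
    fix a assume "A < a"
    then show "\<forall>\<^sub>F x in at_right 0. ?a x < a"
      unfolding eventually_at_right_field using upper by (intro exI[of _ 1]) force
  qed
  then have "alpha_zero \<Omega> s p \<theta> z = A"
    unfolding alpha_zero_def by (intro tendsto_Lim) auto
  then show ?thesis using less c by blast
qed

text \<open>The chain estimate at a boundary point. The radius \<rho>1 precedes \<open>lam\<close>
  because the radius in \<open>connected_to\<close> does; \<open>lam\<close> acts only through the
  \<epsilon> that it provides, hence through \<open>c\<close>.\<close>

lemma gmean_diff_le:
  fixes \<Omega> :: "'a::euclidean_space set"
  assumes \<Omega>: "open \<Omega>" "z \<in> frontier \<Omega>" and u: "integrable (lebesgue_on \<Omega>) u"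
    and p: "1 \<le> p" and \<sigma>: "0 \<le> \<sigma>" and \<theta>: "1 \<le> \<theta>"
    and conn: "connected_to \<Omega> C \<theta> (\<Omega> \<inter> ball z \<delta>') z" "1 \<le> C" "0 < \<delta>'"
    and \<delta>0: "0 < \<delta>0" "\<delta>0 \<le> 1" and s: "\<And>w. w \<in> \<Omega> \<inter> ball z \<delta>0 \<Longrightarrow> \<sigma> \<le> s w"
    and r0: "0 < r0" and dens: "\<And>r. 0 < r \<Longrightarrow> r \<le> r0 \<Longrightarrow> nu \<Omega> s p (ball z r) u \<le> ennreal (k * r powr t)"
    and \<beta>: "p * \<beta> \<le> alpha_exp (real DIM('a)) p \<sigma> \<theta> + t"
  shows "\<exists>\<rho>1>0. \<forall>lam. 0 < lam \<and> lam < 1 \<longrightarrow> (\<exists>c\<ge>0. \<forall>\<rho> x x'. 0 < \<rho> \<and> \<rho> \<le> \<rho>1 \<and>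
    x \<in> \<Omega> \<inter> ball z \<rho> \<and> x' \<in> \<Omega> \<inter> ball z \<rho> \<and>
    (lam * \<rho>) powr \<theta> \<le> bdist \<Omega> x \<and> (lam * \<rho>) powr \<theta> \<le> bdist \<Omega> x' \<longrightarrow>
    \<bar>gmean \<Omega> x u - gmean \<Omega> x' u\<bar> \<le> c * \<rho> powr \<beta>)"
proof -
  let ?d = "bdist \<Omega>" and ?n = "real DIM('a)"
  let ?paths = "\<lambda>\<rho>0 lam \<epsilon>. (\<forall>\<rho>. 0 < \<rho> \<and> \<rho> \<le> \<rho>0 \<longrightarrow>
        (\<forall>x\<in>(\<Omega> \<inter> ball z \<delta>') \<inter> ball z \<rho>. \<forall>x'\<in>(\<Omega> \<inter> ball z \<delta>') \<inter> ball z \<rho>.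
           ?d x \<ge> (lam * \<rho>) powr \<theta> \<and> ?d x' \<ge> (lam * \<rho>) powr \<theta> \<longrightarrow>
             (\<exists>\<gamma>. rectifiable_path \<gamma> \<and> path_image \<gamma> \<subseteq> \<Omega> \<inter> ball z \<delta>' \<and>
                pathstart \<gamma> = x \<and> pathfinish \<gamma> = x' \<and>
                hausdorff 1 (path_image \<gamma>) \<le> ennreal (C * \<rho>) \<and>
                (\<forall>\<tau>\<in>{0..1}. ?d (\<gamma> \<tau>) \<ge> \<epsilon> * \<rho> powr \<theta>))))"
  obtain \<rho>0 where \<rho>0: "0 < \<rho>0"
      and path: "\<forall>lam. 0 < lam \<and> lam < 1 \<longrightarrow> (\<exists>\<epsilon>. 0 < \<epsilon> \<and> \<epsilon> \<le> lam \<and> ?paths \<rho>0 lam \<epsilon>)"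
    using conn(1) unfolding connected_to_def by (elim exE conjE)
  \<comment> \<open>A continuum of length at most C \<rho> starting in \<open>ball z \<rho>\<close>
    stays within D \<rho> of \<open>z\<close>. The radius 2 D \<rho> then also accommodates the
    balls \<Phi> around its points.\<close>
  define D where "D = C + 1"
  have D: "2 \<le> D" using conn(2) by (simp add: D_def)
  obtain a b' where ab: "a = \<delta>0 / (2 * D)" "b' = r0 / (2 * D)" by blast
  then have "0 < a" "0 < b'" using \<delta>0(1) r0 D by auto
  define \<rho>1 where "\<rho>1 = min \<rho>0 (min \<delta>' (min a (min b' 1)))"
  have \<rho>1: "0 < \<rho>1" "\<rho>1 \<le> \<rho>0" "\<rho>1 \<le> \<delta>'" "\<rho>1 \<le> \<delta>0 / (2 * D)" "\<rho>1 \<le> r0 / (2 * D)" "\<rho>1 \<le> 1"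
    unfolding ab[symmetric] \<rho>1_def using \<rho>0 conn(3) \<open>0 < a\<close> \<open>0 < b'\<close> by simp_all
  \<comment> \<open>One power of d is split off from d^(\<sigma> - n/p), to be summed along the
    chain; e' is the exponent of \<rho> in the bound for the rest, d^e.\<close>
  define e where "e = \<sigma> - ?n / p - 1"
  define e' where "e' = (if e \<le> 0 then \<theta> * e else e)"
  define c1 where "c1 = 2 * (4 ^ DIM('a) * 2 powr \<sigma>) * (unit_ball_vol ?n / 6 ^ DIM('a)) powr (- 1 / p)"
  \<comment> \<open>The density constant may be negative, where \<open>ennreal\<close> truncates it
    to 0; the laws for \<open>powr\<close> need it nonnegative.\<close>
  define k' where "k' = max k 0"
  have "0 \<le> c1" "0 \<le> k'" by (simp_all add: c1_def k'_def)
  have \<beta>': "\<beta> \<le> t / p + e' + 1"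
  proof -
    have "p * \<beta> \<le> p * (1 + e') + t"
      using alpha_exp_le[OF p \<theta>, of ?n \<sigma>] \<beta> unfolding e'_def e_def by linarith
    also have "\<dots> = p * (t / p + e' + 1)" using p by (simp add: algebra_simps)
    finally show ?thesis using p by simp
  qed
  show ?thesis
  proof (rule exI[of _ \<rho>1], intro conjI allI impI \<rho>1(1))
    fix lam :: real assume lam: "0 < lam \<and> lam < 1"
    from mp[OF spec[OF path, of lam] lam] obtain \<epsilon> where \<epsilon>: "0 < \<epsilon>" "\<epsilon> \<le> lam" and path': "?paths \<rho>0 lam \<epsilon>"
      by (elim exE conjE)
    \<comment> \<open>For e \<le> 0 the power d^e is largest at the lower bound \<epsilon>
      \<rho>^\<theta>, otherwise at the upper bound D \<rho>.\<close>
    define b where "b = (if e \<le> 0 then \<epsilon> powr e else D powr e)"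
    \<comment> \<open>The last factor comes from the chain: 84 C \<rho> + d(x) \<le> 84 C \<rho> +
      \<rho> \<le> 85 D \<rho>.\<close>
    define c where "c = c1 * (k' * (2 * D) powr t) powr (1 / p) * b * (85 * D)"
    have "0 \<le> b" by (simp add: b_def)
    have "0 \<le> c" using \<open>0 \<le> c1\<close> \<open>0 \<le> b\<close> D by (simp add: c_def)
    show "\<exists>c\<ge>0. \<forall>\<rho> x x'. 0 < \<rho> \<and> \<rho> \<le> \<rho>1 \<and>
      x \<in> \<Omega> \<inter> ball z \<rho> \<and> x' \<in> \<Omega> \<inter> ball z \<rho> \<and>
      (lam * \<rho>) powr \<theta> \<le> ?d x \<and> (lam * \<rho>) powr \<theta> \<le> ?d x' \<longrightarrow>
      \<bar>gmean \<Omega> x u - gmean \<Omega> x' u\<bar> \<le> c * \<rho> powr \<beta>"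
    proof (intro exI[of _ c] conjI allI impI \<open>0 \<le> c\<close>, elim conjE)
      fix \<rho> x x' assume \<rho>: "0 < \<rho>" "\<rho> \<le> \<rho>1" and x: "x \<in> \<Omega> \<inter> ball z \<rho>" "x' \<in> \<Omega> \<inter> ball z \<rho>"
        and d: "(lam * \<rho>) powr \<theta> \<le> ?d x" "(lam * \<rho>) powr \<theta> \<le> ?d x'"
      have small: "2 * D * \<rho> \<le> \<delta>0" "2 * D * \<rho> \<le> r0" "\<rho> \<le> 1"
      proof -
        have "2 * D * \<rho> \<le> 2 * D * \<rho>1" using \<rho> D by (intro mult_left_mono) auto
        moreover have "2 * D * \<rho>1 \<le> \<delta>0" "2 * D * \<rho>1 \<le> r0"
          using \<rho>1(4,5) D by (simp_all add: field_simps)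
        ultimately show "2 * D * \<rho> \<le> \<delta>0" "2 * D * \<rho> \<le> r0" "\<rho> \<le> 1"
          using \<rho> \<rho>1(6) by linarith+
      qed
      have xE: "x \<in> (\<Omega> \<inter> ball z \<delta>') \<inter> ball z \<rho>" "x' \<in> (\<Omega> \<inter> ball z \<delta>') \<inter> ball z \<rho>"
        using x \<rho> \<rho>1(3) by auto
      obtain \<gamma> where \<gamma>: "rectifiable_path \<gamma>" "path_image \<gamma> \<subseteq> \<Omega> \<inter> ball z \<delta>'"
          "pathstart \<gamma> = x" "pathfinish \<gamma> = x'"
          "hausdorff 1 (path_image \<gamma>) \<le> ennreal (C * \<rho>)"
          "\<And>\<tau>. \<tau> \<in> {0..1} \<Longrightarrow> ?d (\<gamma> \<tau>) \<ge> \<epsilon> * \<rho> powr \<theta>"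
        using path'[rule_format, OF conjI[OF \<rho>(1) order_trans[OF \<rho>(2) \<rho>1(2)]] xE conjI[OF d]]
        by blast
      define K where "K = path_image \<gamma>"
      have "path \<gamma>" using \<gamma>(1) by (simp add: rectifiable_path_def)
      then have K: "closed K" "connected K" "x \<in> K" "x' \<in> K"
        using \<gamma>(3,4) unfolding K_def
        by (auto simp: closed_path_image connected_path_image)
      have "0 \<le> C * \<rho>" using conn(2) \<rho>(1) by simp
      have lower: "\<epsilon> * \<rho> powr \<theta> \<le> ?d y" if "y \<in> K" for y
        using that \<gamma>(6) by (auto simp: K_def path_image_def)
      have pos: "0 < ?d y" if "y \<in> K" for y
        using \<epsilon>(1) \<rho>(1) by (intro less_le_trans[OF _ lower[OF that]] mult_pos_pos) auto
      obtain m and f where f: "f 0 = x" "f m = x'" "\<And>i. i \<le> m \<Longrightarrow> f i \<in> K"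
          "\<And>i. i < m \<Longrightarrow> dist (f i) (f (Suc i)) \<le> ?d (f i) / 14"
          and sum: "(\<Sum>i<m. ?d (f i)) \<le> 84 * (C * \<rho>) + ?d x"
        by (rule connected_chain[of K x x' "C * \<rho>" ?d])
          (use K \<gamma>(5) \<open>0 \<le> C * \<rho>\<close> pos bdist_lipschitz in \<open>auto simp: K_def\<close>)
      have near: "dist z y < D * \<rho>" if "y \<in> K" for y
      proof -
        have "dist x y \<le> C * \<rho>"
          using connected_dist_le_hausdorff_1[OF K(2,3) that] \<gamma>(5) \<open>0 \<le> C * \<rho>\<close> by (simp add: K_def)
        moreover have "dist z x < \<rho>" using x by simp
        ultimately show ?thesis using dist_triangle[of z y x] by (simp add: D_def algebra_simps)
      qed
      define N where "N = k' * (2 * D * \<rho>) powr t"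
      have "0 \<le> N" using \<open>0 \<le> k'\<close> by (simp add: N_def)
      have step: "\<bar>gmean \<Omega> (f i) u - gmean \<Omega> (f (Suc i)) u\<bar>
          \<le> c1 * N powr (1 / p) * (b * \<rho> powr e') * ?d (f i)" if i: "i < m" for i
      proof -
        let ?y = "f i"
        have y: "?y \<in> K" "f (Suc i) \<in> K" "?y \<in> \<Omega>" "f (Suc i) \<in> \<Omega>"
          using f(3)[of i] f(3)[of "Suc i"] i \<gamma>(2) by (auto simp: K_def)
        have dy: "0 < ?d ?y" "?d ?y \<le> D * \<rho>" "\<epsilon> * \<rho> powr \<theta> \<le> ?d ?y"
          using pos[OF y(1)] lower[OF y(1)] near[OF y(1)] bdist_le_dist[OF \<Omega>(2), of ?y] by auto
        have Phi: "w \<in> \<Omega>" "dist z w < 2 * D * \<rho>" if "w \<in> Phi \<Omega> ?y" for w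
        proof -
          show "w \<in> \<Omega>"
            using that ball_bdist_subset[OF \<Omega>(1) y(3), of "?d ?y / 6"] dy by (auto simp: Phi_def)
          have "dist ?y w < ?d ?y / 6" using that by (simp add: Phi_def)
          then show "dist z w < 2 * D * \<rho>"
            using near[OF y(1)] dist_triangle[of z w ?y] dy by linarith
        qed
        have "nu \<Omega> s p (Phi \<Omega> ?y) u \<le> nu \<Omega> s p (ball z (2 * D * \<rho>)) u"
          unfolding nu_def using Phi by (intro nn_integral_mono) (auto simp: indicator_def)
        also have "\<dots> \<le> ennreal (k * (2 * D * \<rho>) powr t)"
          using small D \<rho> by (intro dens) auto
        also have "\<dots> \<le> ennreal N"
          unfolding N_def k'_def by (intro ennreal_leI mult_right_mono) auto
        finally have nu: "nu \<Omega> s p (Phi \<Omega> ?y) u \<le> ennreal N" .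
        have "\<bar>gmean \<Omega> ?y u - gmean \<Omega> (f (Suc i)) u\<bar>
            \<le> c1 * ?d ?y powr (\<sigma> - ?n / p) * N powr (1 / p)"
          unfolding c1_def
        proof (rule gmean_step[OF \<Omega>(1) _ u p \<sigma> y(3,4) f(4)[OF i]])
          fix w assume w: "w \<in> Phi \<Omega> ?y"
          show "\<sigma> \<le> s w" using Phi[OF w] small(1) by (intro s) auto
          show "?d w \<le> 1"
            using bdist_le_dist[OF \<Omega>(2), of w] Phi[OF w] small(1) \<delta>0(2) by linarith
        qed (use \<Omega>(2) nu \<open>0 \<le> N\<close> in auto)
        also have "?d ?y powr (\<sigma> - ?n / p) = ?d ?y powr e * ?d ?y"
          using dy(1) by (simp add: e_def powr_diff)
        also have "c1 * (?d ?y powr e * ?d ?y) * N powr (1 / p) = c1 * N powr (1 / p) * (?d ?y powr e) * ?d ?y"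
          by (simp add: ac_simps)
        also have "\<dots> \<le> c1 * N powr (1 / p) * (b * \<rho> powr e') * ?d ?y"
        proof (intro mult_right_mono mult_left_mono)
          show "?d ?y powr e \<le> b * \<rho> powr e'"
          proof (cases "e \<le> 0")
            case True
            then have "?d ?y powr e \<le> (\<epsilon> * \<rho> powr \<theta>) powr e"
              using dy \<epsilon>(1) \<rho>(1) by (intro powr_mono2') auto
            then show ?thesis
              using True \<epsilon>(1) \<rho>(1) by (simp add: b_def e'_def powr_mult powr_powr)
          next
            case False
            then have "?d ?y powr e \<le> (D * \<rho>) powr e"
              using dy by (intro powr_mono2) auto
            then show ?thesis
              using False D \<rho>(1) by (simp add: b_def e'_def powr_mult)
          qed
        qed (use \<open>0 \<le> c1\<close> dy in auto)
        finally show ?thesis .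
      qed
      have "\<bar>gmean \<Omega> x u - gmean \<Omega> x' u\<bar> = \<bar>\<Sum>i<m. gmean \<Omega> (f i) u - gmean \<Omega> (f (Suc i)) u\<bar>"
        using sum_lessThan_telescope'[of "\<lambda>i. gmean \<Omega> (f i) u" m] f(1,2) by simp
      also have "\<dots> \<le> (\<Sum>i<m. c1 * N powr (1 / p) * (b * \<rho> powr e') * ?d (f i))"
        by (intro order_trans[OF sum_abs] sum_mono step) auto
      also have "\<dots> = c1 * N powr (1 / p) * (b * \<rho> powr e') * (\<Sum>i<m. ?d (f i))"
        by (simp add: sum_distrib_left)
      also have "\<dots> \<le> c1 * N powr (1 / p) * (b * \<rho> powr e') * (85 * D * \<rho>)"
      proof (rule mult_left_mono)
        have "?d x \<le> \<rho>" using bdist_le_dist[OF \<Omega>(2), of x] x by auto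
        moreover have "84 * (C * \<rho>) + \<rho> \<le> 85 * D * \<rho>"
          using conn(2) \<rho>(1) by (simp add: D_def algebra_simps)
        ultimately show "(\<Sum>i<m. ?d (f i)) \<le> 85 * D * \<rho>" using sum by linarith
      qed (use \<open>0 \<le> c1\<close> \<open>0 \<le> b\<close> in auto)
      also have "N powr (1 / p) = (k' * (2 * D) powr t) powr (1 / p) * \<rho> powr (t / p)"
        using \<open>0 \<le> k'\<close> D \<rho>(1) by (simp add: N_def powr_mult powr_powr flip: mult.assoc)
      also have "c1 * ((k' * (2 * D) powr t) powr (1 / p) * \<rho> powr (t / p)) * (b * \<rho> powr e') * (85 * D * \<rho>)
          = c * (\<rho> powr (t / p) * \<rho> powr e' * \<rho> powr 1)"
        using \<rho>(1) by (simp add: c_def ac_simps)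
      also have "\<rho> powr (t / p) * \<rho> powr e' * \<rho> powr 1 = \<rho> powr (t / p + e' + 1)"
        by (simp only: powr_add)
      also have "c * \<rho> powr (t / p + e' + 1) \<le> c * \<rho> powr \<beta>"
        using \<open>0 \<le> c\<close> \<rho>(1) small(3) \<beta>' by (intro mult_left_mono powr_mono') auto
      finally show "\<bar>gmean \<Omega> x u - gmean \<Omega> x' u\<bar> \<le> c * \<rho> powr \<beta>" .
    qed
  qed
qed

text \<open>The tails g(k) of the geometric series make the intervals from a(k) - g(k) to a(k) +
  g(k) nested, and \<open>L\<close> is a common point of them; this yields the rate without a
  separate convergence argument.\<close>

lemma geometric_increments_limit:
  fixes a :: "nat \<Rightarrow> real"
  assumes "0 \<le> c" "0 \<le> q" "q < 1" and step: "\<And>k. \<bar>a k - a (Suc k)\<bar> \<le> c * q ^ k"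
  shows "\<exists>L. \<forall>k. \<bar>L - a k\<bar> \<le> c / (1 - q) * q ^ k"
proof -
  define g where "g k = c / (1 - q) * q ^ k" for k
  have "0 \<le> g k" for k using assms by (simp add: g_def)
  have g: "g k - g (Suc k) = c * q ^ k" for k
  proof -
    have "g k - g (Suc k) = (c / (1 - q)) * (1 - q) * q ^ k"
      unfolding g_def power_Suc right_diff_distrib left_diff_distrib by (simp only: mult_1_right mult.assoc)
    then show ?thesis using \<open>q < 1\<close> by simp
  qed
  have inc: "incseq (\<lambda>k. a k - g k)" and dec: "decseq (\<lambda>k. a k + g k)"
    using step g by (intro incseq_SucI decseq_SucI; smt (verit))+
  have cross: "a j - g j \<le> a k + g k" for j k
    using incseqD[OF inc, of j "max j k"] decseqD[OF dec, of k "max j k"] \<open>0 \<le> g (max j k)\<close>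
    by simp
  define L where "L = (SUP k. a k - g k)"
  have "a k - g k \<le> L" "L \<le> a k + g k" for k
    unfolding L_def using cross
    by (auto intro!: cSUP_upper cSUP_least bdd_aboveI2[where M = "a 0 + g 0"])
  then show ?thesis
    unfolding g_def[symmetric] by (intro exI[of _ L]) (auto simp: abs_le_iff algebra_simps)
qed

text \<open>The corkscrew points, and with them \<open>L\<close> and \<open>\<delta>\<close>, are
  fixed before \<open>lam\<close>; the opening of the region affects only \<open>C\<close>. A point
  of the region is compared with the corkscrew point of the dyadic scale just above its distance
  from \<open>z\<close>.\<close>

lemma trace_rate:
  fixes \<Omega> :: "'a::euclidean_space set" and G :: "'a \<Rightarrow> real"
  assumes \<Omega>: "open \<Omega>" "z \<in> frontier \<Omega>" and \<theta>: "1 \<le> \<theta> z" and "0 < \<beta>"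
    and \<delta>': "0 < \<delta>'" and \<eta>: "0 < \<eta>" "\<eta> < 1"
    and corkscrew: "\<And>\<delta>. 0 < \<delta> \<Longrightarrow> \<delta> \<le> \<delta>' \<Longrightarrow>
      \<exists>x\<in>\<Omega>. norm (z - x) < \<delta> \<and> bdist \<Omega> x > (\<eta> * \<delta>) powr \<theta> z"
    and \<rho>1: "0 < \<rho>1" and est: "\<forall>lam. 0 < lam \<and> lam < 1 \<longrightarrow> (\<exists>c\<ge>0. \<forall>\<rho> x x'. 0 < \<rho> \<and> \<rho> \<le> \<rho>1 \<and>
      x \<in> \<Omega> \<inter> ball z \<rho> \<and> x' \<in> \<Omega> \<inter> ball z \<rho> \<and>
      (lam * \<rho>) powr \<theta> z \<le> bdist \<Omega> x \<and> (lam * \<rho>) powr \<theta> z \<le> bdist \<Omega> x' \<longrightarrow>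
      \<bar>G x - G x'\<bar> \<le> c * \<rho> powr \<beta>)"
  shows "\<exists>L. \<exists>\<delta>>0. \<forall>lam. 0 < lam \<and> lam < 1 \<longrightarrow>
    (\<exists>C. \<forall>x\<in>Qreg_loc \<Omega> \<theta> lam \<delta> z. \<bar>L - G x\<bar> \<le> C * norm (z - x) powr \<beta>)"
proof -
  let ?d = "bdist \<Omega>" and ?\<theta> = "\<theta> z"
  define \<delta> where "\<delta> = min \<rho>1 \<delta>'"
  have \<delta>: "0 < \<delta>" "\<delta> \<le> \<rho>1" "\<delta> \<le> \<delta>'" using \<rho>1 \<delta>' by (auto simp: \<delta>_def)
  define D where "D k = \<delta> / 2 ^ k" for k :: nat
  have D: "0 < D k" "D k \<le> \<delta>" "D (Suc k) = D k / 2" for k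
    using \<delta>(1) by (auto simp: D_def field_simps)
  have pw: "(a * r) powr ?\<theta> \<le> (b * r) powr ?\<theta>" if "0 \<le> a" "a \<le> b" "0 \<le> r" for a b r
    using that \<theta> by (intro powr_mono2 mult_right_mono) auto
  have "\<exists>x\<in>\<Omega>. norm (z - x) < D k \<and> ?d x > (\<eta> * D k) powr ?\<theta>" for k
    using D[of k] \<delta>(3) by (intro corkscrew) auto
  then obtain X where X: "\<And>k. X k \<in> \<Omega>" "\<And>k. norm (z - X k) < D k"
      "\<And>k. ?d (X k) > (\<eta> * D k) powr ?\<theta>"
    by metis
  \<comment> \<open>Half of \<eta>, because X(k+1) is a corkscrew point at scale D(k)/2 but is
    compared with X(k) at scale D(k).\<close>
  obtain c where c: "0 \<le> c" and est_c: "\<And>\<rho> x x'. 0 < \<rho> \<Longrightarrow> \<rho> \<le> \<rho>1 \<Longrightarrow>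
      x \<in> \<Omega> \<inter> ball z \<rho> \<Longrightarrow> x' \<in> \<Omega> \<inter> ball z \<rho> \<Longrightarrow>
      (\<eta> / 2 * \<rho>) powr ?\<theta> \<le> ?d x \<Longrightarrow> (\<eta> / 2 * \<rho>) powr ?\<theta> \<le> ?d x' \<Longrightarrow> \<bar>G x - G x'\<bar> \<le> c * \<rho> powr \<beta>"
    using est[rule_format, of "\<eta> / 2"] \<eta> by auto
  define q where "q = 2 powr (- \<beta>)"
  have q: "0 < q" "q < 1"
    using \<open>0 < \<beta>\<close> by (auto simp: q_def powr_less_one)
  have Dq: "D k powr \<beta> = \<delta> powr \<beta> * q ^ k" for k
    using \<delta>(1) by (simp add: D_def q_def powr_divide powr_power powr_minus_divide power_one_over
        flip: powr_realpow) (simp add: powr_powr mult.commute)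
  have "\<bar>G (X k) - G (X (Suc k))\<bar> \<le> c * D k powr \<beta>" for k
  proof (rule est_c)
    have "(\<eta> / 2 * D k) powr ?\<theta> \<le> (\<eta> * D k) powr ?\<theta>" using \<eta> D[of k] by (intro pw) auto
    then show "(\<eta> / 2 * D k) powr ?\<theta> \<le> ?d (X k)" using X(3)[of k] by linarith
    show "(\<eta> / 2 * D k) powr ?\<theta> \<le> ?d (X (Suc k))" using X(3)[of "Suc k"] D(3)[of k] by simp
    show "X k \<in> \<Omega> \<inter> ball z (D k)" "X (Suc k) \<in> \<Omega> \<inter> ball z (D k)"
      using X(1,2)[of k] X(1,2)[of "Suc k"] D[of k] by (auto simp: dist_norm)
  qed (use D[of k] \<delta> in auto)
  then have "\<exists>L. \<forall>k. \<bar>L - G (X k)\<bar> \<le> c * \<delta> powr \<beta> / (1 - q) * q ^ k"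
    unfolding Dq using q c by (intro geometric_increments_limit) (auto simp: mult.assoc)
  then obtain L where L: "\<And>k. \<bar>L - G (X k)\<bar> \<le> c / (1 - q) * D k powr \<beta>"
    unfolding Dq by (auto simp: mult.assoc)
  show ?thesis
  proof (rule exI[of _ L], rule exI[of _ \<delta>], intro conjI allI impI \<delta>(1))
    fix lam :: real assume lam: "0 < lam \<and> lam < 1"
    \<comment> \<open>\<open>\<eta>\<close> serves the corkscrew point. The halving serves
      \<open>x\<close>, whose distance from \<open>z\<close> may be as small as half of the scale
      D(l) of the comparison.\<close>
    define lam' where "lam' = min (lam / 2) \<eta>"
    have lam': "0 < lam'" "lam' < 1" "lam' \<le> lam / 2" "lam' \<le> \<eta>" using lam \<eta> by (auto simp: lam'_def)
    obtain c' where c': "0 \<le> c'" and est_c': "\<And>\<rho> x x'. 0 < \<rho> \<Longrightarrow> \<rho> \<le> \<rho>1 \<Longrightarrow>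
      x \<in> \<Omega> \<inter> ball z \<rho> \<Longrightarrow> x' \<in> \<Omega> \<inter> ball z \<rho> \<Longrightarrow>
      (lam' * \<rho>) powr ?\<theta> \<le> ?d x \<Longrightarrow> (lam' * \<rho>) powr ?\<theta> \<le> ?d x' \<Longrightarrow> \<bar>G x - G x'\<bar> \<le> c' * \<rho> powr \<beta>"
      using est[rule_format, of lam'] lam' by auto
    define C where "C = (c / (1 - q) + c') * 2 powr \<beta>"
    show "\<exists>C. \<forall>x\<in>Qreg_loc \<Omega> \<theta> lam \<delta> z. \<bar>L - G x\<bar> \<le> C * norm (z - x) powr \<beta>"
    proof (intro exI[of _ C] ballI)
      fix x assume "x \<in> Qreg_loc \<Omega> \<theta> lam \<delta> z"
      then have x: "x \<in> \<Omega>" "?d x > (lam * norm (z - x)) powr ?\<theta>" "norm (z - x) < \<delta>"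
        by (auto simp: Qreg_loc_def Qreg_def dist_norm)
      have "z \<notin> \<Omega>" using \<Omega> by (simp add: frontier_def interior_open)
      then have r: "0 < norm (z - x)" using x(1) by auto
      have "\<exists>k. D k \<le> norm (z - x)"
        using real_arch_pow_inv[of "norm (z - x) / \<delta>" "1/2"] r \<delta>(1)
        by (auto simp: D_def field_simps power_one_over intro: less_imp_le)
      \<comment> \<open>This index is positive because D(0) = \<delta> exceeds the distance; its
        predecessor is the scale of comparison.\<close>
      define k where "k = (LEAST k. D k \<le> norm (z - x))"
      have k: "D k \<le> norm (z - x)" unfolding k_def by (rule LeastI_ex) fact
      have "k \<noteq> 0"
      proof
        assume "k = 0"
        then show False using k x(3) by (simp add: D_def)
      qed
      then obtain l where l: "k = Suc l" by (cases k) auto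
      have "\<not> D l \<le> norm (z - x)" by (rule not_less_Least) (use l in \<open>simp add: k_def\<close>)
      then have lr: "norm (z - x) < D l" "D l \<le> 2 * norm (z - x)" using k D(3)[of l] l by auto
      have "\<bar>G x - G (X l)\<bar> \<le> c' * D l powr \<beta>"
      proof (rule est_c')
        have "(lam' * D l) powr ?\<theta> \<le> (lam / 2 * D l) powr ?\<theta>" using lam' D[of l] by (intro pw) auto
        also have "\<dots> \<le> (lam * norm (z - x)) powr ?\<theta>"
          using lam lr D[of l] \<theta> by (intro powr_mono2) auto
        finally show "(lam' * D l) powr ?\<theta> \<le> ?d x" using x(2) by linarith
        have "(lam' * D l) powr ?\<theta> \<le> (\<eta> * D l) powr ?\<theta>" using lam' D[of l] by (intro pw) auto
        then show "(lam' * D l) powr ?\<theta> \<le> ?d (X l)" using X(3)[of l] by linarith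
      qed (use x(1) lr(1) X(1,2)[of l] D[of l] \<delta> in \<open>auto simp: dist_norm\<close>)
      then have "\<bar>L - G x\<bar> \<le> (c / (1 - q) + c') * D l powr \<beta>"
        using L[of l] by (simp add: distrib_right)
      also have "\<dots> \<le> (c / (1 - q) + c') * (2 * norm (z - x)) powr \<beta>"
        using c c' q lr D[of l] \<open>0 < \<beta>\<close> by (intro mult_left_mono powr_mono2) auto
      also have "\<dots> = C * norm (z - x) powr \<beta>"
        by (simp add: C_def powr_mult)
      finally show "\<bar>L - G x\<bar> \<le> C * norm (z - x) powr \<beta>" .
    qed
  qed
qed

lemma rate_imp_tendsto:
  fixes G :: "'a::euclidean_space \<Rightarrow> real"
  assumes "0 < \<beta>" "0 < \<delta>" "\<And>x. x \<in> Qreg_loc \<Omega> \<theta> lam \<delta> z \<Longrightarrow> \<bar>L - G x\<bar> \<le> C * norm (z - x) powr \<beta>"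
  shows "(G \<longlongrightarrow> L) (at z within Qreg \<Omega> \<theta> lam z)"
proof -
  have "((\<lambda>x. C * norm (z - x) powr \<beta>) \<longlongrightarrow> C * norm (z - z) powr \<beta>) (at z within Qreg \<Omega> \<theta> lam z)"
    using assms(1) by (intro tendsto_intros) auto
  then have "((\<lambda>x. C * norm (z - x) powr \<beta>) \<longlongrightarrow> 0) (at z within Qreg \<Omega> \<theta> lam z)"
    by simp
  moreover have "\<forall>\<^sub>F x in at z within Qreg \<Omega> \<theta> lam z. norm (G x - L) \<le> C * norm (z - x) powr \<beta>"
    unfolding eventually_at
    using assms(2,3) by (intro exI[of _ \<delta>]) (auto simp: Qreg_loc_def dist_commute abs_minus_commute)
  ultimately have "((\<lambda>x. G x - L) \<longlongrightarrow> 0) (at z within Qreg \<Omega> \<theta> lam z)"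
    by (rule Lim_null_comparison[rotated])
  then show ?thesis by (simp add: LIM_zero_iff)
qed

text \<open>Both conclusions of the theorem at a single boundary point. The bound \<open>b\<close>
  on the rates stands for (\<alpha>_0 + t)/p and does not involve \<open>u\<close>, so that the
  property passes to linear combinations. Uniqueness of \<open>L\<close> is not built in; it comes
  from the corkscrew condition.\<close>

definition has_trace ::
  "'a::euclidean_space set \<Rightarrow> ('a \<Rightarrow> real) \<Rightarrow> real \<Rightarrow> ('a \<Rightarrow> real) \<Rightarrow> 'a \<Rightarrow> real \<Rightarrow> bool" where
  "has_trace \<Omega> \<theta> b u z L \<longleftrightarrow>
     (\<forall>lam. 0 < lam \<and> lam < 1 \<longrightarrow> ((\<lambda>x. gmean \<Omega> x u) \<longlongrightarrow> L) (at z within Qreg \<Omega> \<theta> lam z)) \<and>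
     (\<forall>\<beta>. 0 < \<beta> \<and> \<beta> < b \<longrightarrow> (\<exists>\<delta>>0. \<forall>lam. 0 < lam \<and> lam < 1 \<longrightarrow>
        (\<exists>C. \<forall>x\<in>Qreg_loc \<Omega> \<theta> lam \<delta> z. \<bar>L - gmean \<Omega> x u\<bar> \<le> C * norm (z - x) powr \<beta>)))"

text \<open>A single rate, here b/2, already forces the limit along every region.\<close>

lemma has_traceI:
  assumes "0 < b" and rate: "\<And>\<beta>. 0 < \<beta> \<Longrightarrow> \<beta> < b \<Longrightarrow> \<exists>\<delta>>0. \<forall>lam. 0 < lam \<and> lam < 1 \<longrightarrow>
        (\<exists>C. \<forall>x\<in>Qreg_loc \<Omega> \<theta> lam \<delta> z. \<bar>L - gmean \<Omega> x u\<bar> \<le> C * norm (z - x) powr \<beta>)"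
  shows "has_trace \<Omega> \<theta> b u z L"
proof -
  obtain \<delta> where "0 < \<delta>" and *: "\<forall>lam. 0 < lam \<and> lam < 1 \<longrightarrow>
        (\<exists>C. \<forall>x\<in>Qreg_loc \<Omega> \<theta> lam \<delta> z. \<bar>L - gmean \<Omega> x u\<bar> \<le> C * norm (z - x) powr (b / 2))"
    using rate[of "b / 2"] \<open>0 < b\<close> by auto
  have "((\<lambda>x. gmean \<Omega> x u) \<longlongrightarrow> L) (at z within Qreg \<Omega> \<theta> lam z)" if lam: "0 < lam" "lam < 1" for lam
  proof -
    obtain C where "\<And>x. x \<in> Qreg_loc \<Omega> \<theta> lam \<delta> z \<Longrightarrow> \<bar>L - gmean \<Omega> x u\<bar> \<le> C * norm (z - x) powr (b / 2)"
      using * lam by blast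
    then show ?thesis using \<open>0 < b\<close> \<open>0 < \<delta>\<close> by (intro rate_imp_tendsto[of "b / 2" \<delta>]) auto
  qed
  then show ?thesis using rate unfolding has_trace_def by blast
qed

text \<open>Makes limits along the region unique.\<close>

lemma corkscrew_not_bot:
  fixes \<Omega> :: "'a::euclidean_space set"
  assumes "open \<Omega>" "z \<in> frontier \<Omega>" "0 < \<delta>'"
    and "\<And>\<delta>. 0 < \<delta> \<Longrightarrow> \<delta> \<le> \<delta>' \<Longrightarrow> \<exists>x\<in>Qreg \<Omega> \<theta> lam z. norm (z - x) < \<delta>"
  shows "at z within Qreg \<Omega> \<theta> lam z \<noteq> bot"
  unfolding trivial_limit_within islimpt_approachable not_not
proof (intro allI impI)
  fix e :: real assume "0 < e"
  then obtain x where x: "x \<in> Qreg \<Omega> \<theta> lam z" "norm (z - x) < min e \<delta>'"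
    using assms(4)[of "min e \<delta>'"] assms(3) by auto
  have "z \<notin> \<Omega>" using assms(1,2) by (simp add: frontier_def interior_open)
  then have "x \<noteq> z" using x(1) by (auto simp: Qreg_def)
  then show "\<exists>x'\<in>Qreg \<Omega> \<theta> lam z. x' \<noteq> z \<and> dist x' z < e"
    using x by (auto simp: dist_norm norm_minus_commute)
qed

text \<open>Every \<beta> requires its own radius, on which \<open>alpha_lower\<close> already
  exceeds p \<beta> - t, so the rate argument returns a separate limit for each \<beta>. All of them
  are limits along the region with opening \<open>lam0\<close>, hence equal.\<close>

lemma has_trace_exists:
  fixes \<Omega> :: "'a::euclidean_space set"
  assumes \<Omega>: "open \<Omega>" "z \<in> frontier \<Omega>" and u: "integrable (lebesgue_on \<Omega>) u"
    and p: "1 \<le> p" and \<theta>: "1 \<le> \<theta> z" and s: "\<And>x. x \<in> \<Omega> \<Longrightarrow> 0 \<le> s x" "bounded (s ` \<Omega>)"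
    and conn: "connected_to \<Omega> C (\<theta> z) (\<Omega> \<inter> ball z \<delta>') z" "1 \<le> C" "0 < \<delta>'"
    and \<eta>: "0 < \<eta>" "\<eta> < 1" and lam0: "0 < lam0" "lam0 < 1"
    and corkscrew: "\<And>\<delta>. 0 < \<delta> \<Longrightarrow> \<delta> \<le> \<delta>' \<Longrightarrow>
      \<exists>x\<in>Qreg \<Omega> \<theta> lam0 z. norm (z - x) < \<delta> \<and> bdist \<Omega> x > (\<eta> * \<delta>) powr \<theta> z"
    and r0: "0 < r0" and dens: "\<And>r. 0 < r \<Longrightarrow> r \<le> r0 \<Longrightarrow> nu \<Omega> s p (ball z r) u \<le> ennreal (k * r powr t)"
    and \<alpha>: "- t < alpha_zero \<Omega> s p \<theta> z"
  shows "\<exists>L. has_trace \<Omega> \<theta> ((alpha_zero \<Omega> s p \<theta> z + t) / p) u z L"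
proof -
  let ?b = "(alpha_zero \<Omega> s p \<theta> z + t) / p"
  let ?rate = "\<lambda>\<beta> L \<delta>. \<forall>lam. 0 < lam \<and> lam < 1 \<longrightarrow>
        (\<exists>C. \<forall>x\<in>Qreg_loc \<Omega> \<theta> lam \<delta> z. \<bar>L - gmean \<Omega> x u\<bar> \<le> C * norm (z - x) powr \<beta>)"
  have b: "0 < ?b" using \<alpha> p by simp
  have ex: "\<exists>L. \<exists>\<delta>>0. ?rate \<beta> L \<delta>" if \<beta>: "0 < \<beta>" "\<beta> < ?b" for \<beta>
  proof -
    have "p * \<beta> - t < alpha_zero \<Omega> s p \<theta> z" using \<beta> p by (simp add: field_simps)
    then obtain \<delta>0 where \<delta>0: "0 < \<delta>0" "\<delta>0 \<le> 1" "p * \<beta> - t < alpha_lower \<Omega> s p \<theta> \<delta>0 z"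
      using alpha_lower_gt[of p \<theta> z \<Omega> s "p * \<beta> - t"] p \<theta> \<Omega>(2) s(2) by auto
    define \<sigma> where "\<sigma> = s_lower \<Omega> s \<delta>0 z"
    have \<sigma>: "0 \<le> \<sigma>"
      unfolding \<sigma>_def s_lower_def using frontier_ball_nonempty[OF \<Omega>(2) \<delta>0(1)] s(1)
      by (intro cINF_greatest) auto
    have bdd: "bdd_below (s ` (\<Omega> \<inter> ball z \<delta>0))"
      using s(1) by (intro bdd_belowI2[of _ 0]) auto
    have s\<sigma>: "\<sigma> \<le> s w" if "w \<in> \<Omega> \<inter> ball z \<delta>0" for w
      unfolding \<sigma>_def s_lower_def using that bdd by (intro cINF_lower)
    have "p * \<beta> \<le> alpha_exp (real DIM('a)) p \<sigma> (\<theta> z) + t"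
      using \<delta>0(3) by (simp add: alpha_lower_def \<sigma>_def)
    from gmean_diff_le[OF \<Omega> u p \<sigma> \<theta> conn \<delta>0(1,2) s\<sigma> r0 dens this]
    obtain \<rho>1 where "0 < \<rho>1" and est: "\<forall>lam. 0 < lam \<and> lam < 1 \<longrightarrow> (\<exists>c\<ge>0. \<forall>\<rho> x x'. 0 < \<rho> \<and> \<rho> \<le> \<rho>1 \<and>
      x \<in> \<Omega> \<inter> ball z \<rho> \<and> x' \<in> \<Omega> \<inter> ball z \<rho> \<and>
      (lam * \<rho>) powr \<theta> z \<le> bdist \<Omega> x \<and> (lam * \<rho>) powr \<theta> z \<le> bdist \<Omega> x' \<longrightarrow>
      \<bar>gmean \<Omega> x u - gmean \<Omega> x' u\<bar> \<le> c * \<rho> powr \<beta>)"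
      by blast
    have "\<exists>x\<in>\<Omega>. norm (z - x) < \<delta> \<and> bdist \<Omega> x > (\<eta> * \<delta>) powr \<theta> z" if "0 < \<delta>" "\<delta> \<le> \<delta>'" for \<delta>
      using corkscrew[OF that] by (auto simp: Qreg_def)
    from trace_rate[where G = "\<lambda>x. gmean \<Omega> x u" and \<theta> = \<theta> and z = z, OF \<Omega> \<theta> \<beta>(1) conn(3) \<eta> this \<open>0 < \<rho>1\<close> est] show ?thesis .
  qed
  have tends: "((\<lambda>x. gmean \<Omega> x u) \<longlongrightarrow> L) (at z within Qreg \<Omega> \<theta> lam0 z)"
    if \<beta>: "0 < \<beta>" and \<delta>: "0 < \<delta>" and r: "?rate \<beta> L \<delta>" for \<beta> L \<delta>
  proof -
    obtain C where "\<And>x. x \<in> Qreg_loc \<Omega> \<theta> lam0 \<delta> z \<Longrightarrow> \<bar>L - gmean \<Omega> x u\<bar> \<le> C * norm (z - x) powr \<beta>"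
      using r lam0 by blast
    then show ?thesis by (rule rate_imp_tendsto[OF \<beta> \<delta>])
  qed
  have nb: "at z within Qreg \<Omega> \<theta> lam0 z \<noteq> bot"
    using corkscrew by (intro corkscrew_not_bot[OF \<Omega> conn(3)]) blast
  obtain L \<delta>1 where L: "0 < \<delta>1" "?rate (?b / 2) L \<delta>1"
    using ex[of "?b / 2"] b by auto
  have "has_trace \<Omega> \<theta> ?b u z L"
  proof (rule has_traceI[OF b])
    fix \<beta> assume \<beta>: "0 < \<beta>" "\<beta> < ?b"
    obtain L' \<delta> where L': "0 < \<delta>" "?rate \<beta> L' \<delta>" using ex[OF \<beta>] by blast
    have "L' = L"
      using tends[OF \<beta>(1) L'] tends[OF _ L] b by (intro tendsto_unique[OF nb]) auto
    then show "\<exists>\<delta>>0. ?rate \<beta> L \<delta>" using L' by blast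
  qed
  then show ?thesis ..
qed

subsection \<open>The trace operator\<close>

lemma gmean_add:
  fixes \<Omega> :: "'a::euclidean_space set"
  assumes "open \<Omega>" "integrable (lebesgue_on \<Omega>) u" "integrable (lebesgue_on \<Omega>) v" "x \<in> \<Omega>"
  shows "gmean \<Omega> x (\<lambda>x. u x + v x) = gmean \<Omega> x u + gmean \<Omega> x v"
proof -
  have "0 \<le> bdist \<Omega> x" by (simp add: bdist_def infdist_nonneg)
  then have "Phi \<Omega> x \<subseteq> \<Omega>"
    unfolding Phi_def by (intro ball_bdist_subset[OF assms(1,4)]) auto
  then have "set_integrable lebesgue (Phi \<Omega> x) u" "set_integrable lebesgue (Phi \<Omega> x) v"
    by (intro set_integrable_of_lebesgue_on[OF _ assms(1)] assms(2,3); simp add: Phi_def)+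
  then show ?thesis by (simp add: gmean_def set_integral_add distrib_left)
qed

lemma gmean_scale: "gmean \<Omega> x (\<lambda>x. c * u x) = c * gmean \<Omega> x u"
  by (simp add: gmean_def)

lemma gmean_null:
  fixes \<Omega> :: "'a::euclidean_space set"
  assumes "open \<Omega>" "AE x in lebesgue_on \<Omega>. u x = 0" "x \<in> \<Omega>"
  shows "gmean \<Omega> x u = 0"
proof -
  have "0 \<le> bdist \<Omega> x" by (simp add: bdist_def infdist_nonneg)
  then have sub: "Phi \<Omega> x \<subseteq> \<Omega>"
    unfolding Phi_def by (intro ball_bdist_subset[OF assms(1,3)]) auto
  have "AE x in lebesgue. x \<in> \<Omega> \<longrightarrow> u x = 0"
    using assms(1,2) by (simp add: AE_restrict_space_iff)
  then have "AE y in lebesgue. indicator (Phi \<Omega> x) y *\<^sub>R u y = 0"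
    by eventually_elim (use sub in \<open>auto simp: indicator_def\<close>)
  then show ?thesis
    unfolding gmean_def set_lebesgue_integral_def by (simp add: integral_eq_zero_AE)
qed

lemma eventually_Qreg: "(\<And>x. x \<in> \<Omega> \<Longrightarrow> P x) \<Longrightarrow> \<forall>\<^sub>F x in at z within Qreg \<Omega> \<theta> lam z. P x"
  by (auto simp: eventually_at_filter Qreg_def)

lemma Qreg_loc_subset: "Qreg_loc \<Omega> \<theta> lam \<delta> z \<subseteq> \<Omega>"
  by (auto simp: Qreg_loc_def Qreg_def)

lemma has_trace_null:
  assumes "open \<Omega>" "AE x in lebesgue_on \<Omega>. u x = 0"
  shows "has_trace \<Omega> \<theta> b u z 0"
  unfolding has_trace_def
proof (intro conjI allI impI)
  fix lam
  show "((\<lambda>x. gmean \<Omega> x u) \<longlongrightarrow> 0) (at z within Qreg \<Omega> \<theta> lam z)"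
    by (intro tendsto_eventually eventually_Qreg gmean_null assms)
next
  fix \<beta>
  show "\<exists>\<delta>>0. \<forall>lam. 0 < lam \<and> lam < 1 \<longrightarrow>
      (\<exists>C. \<forall>x\<in>Qreg_loc \<Omega> \<theta> lam \<delta> z. \<bar>0 - gmean \<Omega> x u\<bar> \<le> C * norm (z - x) powr \<beta>)"
  proof (rule exI[of _ 1], intro conjI allI impI)
    fix lam
    show "\<exists>C. \<forall>x\<in>Qreg_loc \<Omega> \<theta> lam 1 z. \<bar>0 - gmean \<Omega> x u\<bar> \<le> C * norm (z - x) powr \<beta>"
      using gmean_null[OF assms] Qreg_loc_subset[of \<Omega> \<theta> lam 1 z] by (intro exI[of _ 0]) force
  qed simp
qed

lemma has_trace_scale:
  assumes "has_trace \<Omega> \<theta> b u z L"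
  shows "has_trace \<Omega> \<theta> b (\<lambda>x. c * u x) z (c * L)"
  unfolding has_trace_def gmean_scale
proof (intro conjI allI impI)
  fix lam :: real assume "0 < lam \<and> lam < 1"
  then show "((\<lambda>x. c * gmean \<Omega> x u) \<longlongrightarrow> c * L) (at z within Qreg \<Omega> \<theta> lam z)"
    using assms unfolding has_trace_def by (intro tendsto_mult_left) blast
next
  fix \<beta> assume "0 < \<beta> \<and> \<beta> < b"
  then obtain \<delta> where \<delta>: "0 < \<delta>" and *: "\<And>lam. 0 < lam \<and> lam < 1 \<Longrightarrow>
      \<exists>C. \<forall>x\<in>Qreg_loc \<Omega> \<theta> lam \<delta> z. \<bar>L - gmean \<Omega> x u\<bar> \<le> C * norm (z - x) powr \<beta>"
    using assms unfolding has_trace_def by blast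
  show "\<exists>\<delta>>0. \<forall>lam. 0 < lam \<and> lam < 1 \<longrightarrow>
      (\<exists>C. \<forall>x\<in>Qreg_loc \<Omega> \<theta> lam \<delta> z. \<bar>c * L - c * gmean \<Omega> x u\<bar> \<le> C * norm (z - x) powr \<beta>)"
  proof (rule exI[of _ \<delta>], intro conjI allI impI \<delta>)
    fix lam :: real assume "0 < lam \<and> lam < 1"
    then obtain C where C: "\<And>x. x \<in> Qreg_loc \<Omega> \<theta> lam \<delta> z \<Longrightarrow>
        \<bar>L - gmean \<Omega> x u\<bar> \<le> C * norm (z - x) powr \<beta>"
      using * by blast
    have "\<bar>c * L - c * gmean \<Omega> x u\<bar> \<le> \<bar>c\<bar> * C * norm (z - x) powr \<beta>"
      if "x \<in> Qreg_loc \<Omega> \<theta> lam \<delta> z" for x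
    proof -
      have "\<bar>c * L - c * gmean \<Omega> x u\<bar> = \<bar>c\<bar> * \<bar>L - gmean \<Omega> x u\<bar>"
        by (simp flip: right_diff_distrib add: abs_mult)
      also have "\<dots> \<le> \<bar>c\<bar> * (C * norm (z - x) powr \<beta>)"
        using C[OF that] by (rule mult_left_mono) simp
      finally show ?thesis by (simp add: mult.assoc)
    qed
    then show "\<exists>C. \<forall>x\<in>Qreg_loc \<Omega> \<theta> lam \<delta> z.
        \<bar>c * L - c * gmean \<Omega> x u\<bar> \<le> C * norm (z - x) powr \<beta>" by blast
  qed
qed

lemma has_trace_add:
  fixes \<Omega> :: "'a::euclidean_space set"
  assumes \<Omega>: "open \<Omega>" and int: "integrable (lebesgue_on \<Omega>) u" "integrable (lebesgue_on \<Omega>) v"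
    and u: "has_trace \<Omega> \<theta> b u z L" and v: "has_trace \<Omega> \<theta> b v z M"
  shows "has_trace \<Omega> \<theta> b (\<lambda>x. u x + v x) z (L + M)"
  unfolding has_trace_def
proof (intro conjI allI impI)
  fix lam :: real assume lam: "0 < lam \<and> lam < 1"
  have "((\<lambda>x. gmean \<Omega> x u + gmean \<Omega> x v) \<longlongrightarrow> L + M) (at z within Qreg \<Omega> \<theta> lam z)"
    using u v lam unfolding has_trace_def by (intro tendsto_add) blast+
  moreover have "\<forall>\<^sub>F x in at z within Qreg \<Omega> \<theta> lam z.
      gmean \<Omega> x (\<lambda>x. u x + v x) = gmean \<Omega> x u + gmean \<Omega> x v"
    by (intro eventually_Qreg gmean_add[OF \<Omega> int])
  ultimately show "((\<lambda>x. gmean \<Omega> x (\<lambda>x. u x + v x)) \<longlongrightarrow> L + M) (at z within Qreg \<Omega> \<theta> lam z)"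
    by (subst tendsto_cong)
next
  fix \<beta> assume \<beta>: "0 < \<beta> \<and> \<beta> < b"
  obtain \<delta>1 where \<delta>1: "0 < \<delta>1" and *: "\<And>lam. 0 < lam \<and> lam < 1 \<Longrightarrow>
      \<exists>C. \<forall>x\<in>Qreg_loc \<Omega> \<theta> lam \<delta>1 z. \<bar>L - gmean \<Omega> x u\<bar> \<le> C * norm (z - x) powr \<beta>"
    using u \<beta> unfolding has_trace_def by blast
  obtain \<delta>2 where \<delta>2: "0 < \<delta>2" and **: "\<And>lam. 0 < lam \<and> lam < 1 \<Longrightarrow>
      \<exists>C. \<forall>x\<in>Qreg_loc \<Omega> \<theta> lam \<delta>2 z. \<bar>M - gmean \<Omega> x v\<bar> \<le> C * norm (z - x) powr \<beta>"
    using v \<beta> unfolding has_trace_def by blast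
  show "\<exists>\<delta>>0. \<forall>lam. 0 < lam \<and> lam < 1 \<longrightarrow> (\<exists>C. \<forall>x\<in>Qreg_loc \<Omega> \<theta> lam \<delta> z.
      \<bar>L + M - gmean \<Omega> x (\<lambda>x. u x + v x)\<bar> \<le> C * norm (z - x) powr \<beta>)"
  proof (rule exI[of _ "min \<delta>1 \<delta>2"], intro conjI allI impI)
    fix lam :: real assume lam: "0 < lam \<and> lam < 1"
    obtain C1 where C1: "\<And>x. x \<in> Qreg_loc \<Omega> \<theta> lam \<delta>1 z \<Longrightarrow>
        \<bar>L - gmean \<Omega> x u\<bar> \<le> C1 * norm (z - x) powr \<beta>"
      using *[OF lam] by blast
    obtain C2 where C2: "\<And>x. x \<in> Qreg_loc \<Omega> \<theta> lam \<delta>2 z \<Longrightarrow>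
        \<bar>M - gmean \<Omega> x v\<bar> \<le> C2 * norm (z - x) powr \<beta>"
      using **[OF lam] by blast
    have "\<bar>L + M - gmean \<Omega> x (\<lambda>x. u x + v x)\<bar> \<le> (C1 + C2) * norm (z - x) powr \<beta>"
      if x: "x \<in> Qreg_loc \<Omega> \<theta> lam (min \<delta>1 \<delta>2) z" for x
    proof -
      have "x \<in> \<Omega>" "x \<in> Qreg_loc \<Omega> \<theta> lam \<delta>1 z" "x \<in> Qreg_loc \<Omega> \<theta> lam \<delta>2 z"
        using x by (auto simp: Qreg_loc_def Qreg_def)
      then show ?thesis
        using C1[of x] C2[of x] gmean_add[OF \<Omega> int, of x] by (simp add: distrib_right)
    qed
    then show "\<exists>C. \<forall>x\<in>Qreg_loc \<Omega> \<theta> lam (min \<delta>1 \<delta>2) z.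
      \<bar>L + M - gmean \<Omega> x (\<lambda>x. u x + v x)\<bar> \<le> C * norm (z - x) powr \<beta>" by blast
  qed (use \<delta>1 \<delta>2 in auto)
qed

section \<open>Existence of traces almost everywhere, and Borel approach points\<close>

lemma uniform_corkscrewE:
  assumes "uniform_corkscrew \<Omega> \<Gamma> \<theta> \<delta>'"
  obtains lam0 \<eta> where "0 < lam0" "lam0 < 1" "0 < \<eta>" "\<eta> < 1"
    "\<forall>z\<in>\<Gamma>. \<forall>\<delta>. 0 < \<delta> \<longrightarrow> \<delta> \<le> \<delta>' \<longrightarrow>
      (\<exists>x\<in>Qreg \<Omega> \<theta> lam0 z. norm (z - x) < \<delta> \<and> bdist \<Omega> x > (\<eta> * \<delta>) powr \<theta> z)"
proof -
  obtain lam0 \<eta> where 1: "0 < lam0" "lam0 < 1" "0 < \<eta>" "\<eta> < 1"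
    and 2: "\<forall>z\<in>\<Gamma>. \<forall>\<delta>. 0 < \<delta> \<and> \<delta> \<le> \<delta>' \<longrightarrow> (\<exists>x\<in>Qreg \<Omega> \<theta> lam0 z. \<eta> * \<delta> < norm (z - x) \<and>
      norm (z - x) < \<delta> \<and> bdist \<Omega> x > (\<eta> * \<delta>) powr \<theta> z)"
    using assms unfolding uniform_corkscrew_def by (elim exE conjE)
  show thesis by (rule that[OF 1]) (use 2 in fast)
qed

text \<open>The exceptional set has two parts: the points of infinite upper t-density of
  \<open>nu\<close>, which depend on \<open>u\<close>, and those violating the condition on the
  exponent, which do not.\<close>

lemma has_trace_ae:
  fixes \<Omega> \<Gamma> :: "'a::euclidean_space set"
  assumes \<Omega>: "open \<Omega>" "\<Gamma> \<subseteq> frontier \<Omega>" and p: "1 \<le> p" and t: "0 \<le> t" and \<delta>': "0 < \<delta>'"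
    and s: "\<And>x. x \<in> \<Omega> \<Longrightarrow> 0 \<le> s x" "bounded (s ` \<Omega>)"
    and \<theta>: "\<And>z. z \<in> \<Gamma> \<Longrightarrow> 1 \<le> \<theta> z"
    and ck: "uniform_corkscrew \<Omega> \<Gamma> \<theta> \<delta>'" and conn: "uniformly_connected \<Omega> \<Gamma> \<theta> \<delta>'"
    and \<alpha>: "hausdorff t {z \<in> \<Gamma>. \<not> alpha_zero \<Omega> s p \<theta> z > - t} = 0"
    and u: "u \<in> Nspace \<Omega> s p"
  shows "\<exists>N. hausdorff t N = 0 \<and>
    (\<forall>z\<in>\<Gamma> - N. \<exists>L. has_trace \<Omega> \<theta> ((alpha_zero \<Omega> s p \<theta> z + t) / p) u z L)"
proof -
  let ?N1 = "{z. \<not> (\<exists>k r0. 0 < r0 \<and> (\<forall>r. 0 < r \<and> r \<le> r0 \<longrightarrow>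
    nu \<Omega> s p (ball z r) u \<le> ennreal (k * r powr t)))}"
  let ?N2 = "{z \<in> \<Gamma>. \<not> alpha_zero \<Omega> s p \<theta> z > - t}"
  have int: "integrable (lebesgue_on \<Omega>) u" and fin: "nu \<Omega> s p \<Omega> u < \<infinity>"
    using u by (auto simp: Nspace_def)
  have "hausdorff t ?N1 = 0"
  proof (rule hausdorff_infinite_density_null[OF t fin])
    show "nu \<Omega> s p A u \<le> nu \<Omega> s p B u" if "A \<subseteq> B" for A B
      unfolding nu_def using that by (intro nn_integral_mono) (auto simp: indicator_def)
    show "(\<Sum>i\<in>I. nu \<Omega> s p (A i) u) \<le> nu \<Omega> s p \<Omega> u"
      if "finite I" "disjoint_family_on A I" for I :: "'a set" and A
      unfolding nu_def using that
      by (intro sum_set_nn_integral_le) (auto simp: disjoint_family_on_def)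
  qed
  with \<alpha> have null: "hausdorff t (?N1 \<union> ?N2) = 0" by (intro hausdorff_null_Un)
  obtain C where C: "1 \<le> C" "\<And>z. z \<in> \<Gamma> \<Longrightarrow> connected_to \<Omega> C (\<theta> z) (\<Omega> \<inter> ball z \<delta>') z"
    using conn unfolding uniformly_connected_def by (elim bexE exE conjE) (simp add: Ball_def)
  obtain lam0 \<eta> where lam0: "0 < lam0" "lam0 < 1" and \<eta>: "0 < \<eta>" "\<eta> < 1"
    and corkscrew: "\<forall>z\<in>\<Gamma>. \<forall>\<delta>. 0 < \<delta> \<longrightarrow> \<delta> \<le> \<delta>' \<longrightarrow>
      (\<exists>x\<in>Qreg \<Omega> \<theta> lam0 z. norm (z - x) < \<delta> \<and> bdist \<Omega> x > (\<eta> * \<delta>) powr \<theta> z)"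
    by (rule uniform_corkscrewE[OF ck])
  have "\<exists>L. has_trace \<Omega> \<theta> ((alpha_zero \<Omega> s p \<theta> z + t) / p) u z L" if z: "z \<in> \<Gamma> - (?N1 \<union> ?N2)" for z
  proof -
    have "z \<in> \<Gamma>" "- t < alpha_zero \<Omega> s p \<theta> z" using z by auto
    obtain k r0 where r0: "0 < r0" "\<And>r. 0 < r \<Longrightarrow> r \<le> r0 \<Longrightarrow> nu \<Omega> s p (ball z r) u \<le> ennreal (k * r powr t)"
      using z by blast
    show ?thesis
    proof (rule has_trace_exists[where \<theta> = \<theta> and s = s and z = z, OF \<Omega>(1) _ int p])
      show "z \<in> frontier \<Omega>" using \<open>z \<in> \<Gamma>\<close> \<Omega>(2) by blast
      show "\<exists>x\<in>Qreg \<Omega> \<theta> lam0 z. norm (z - x) < \<delta> \<and> bdist \<Omega> x > (\<eta> * \<delta>) powr \<theta> z"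
        if "0 < \<delta>" "\<delta> \<le> \<delta>'" for \<delta>
        using corkscrew \<open>z \<in> \<Gamma>\<close> that by simp
    qed (fact \<theta>[OF \<open>z \<in> \<Gamma>\<close>] s C(1) C(2)[OF \<open>z \<in> \<Gamma>\<close>] \<delta>' \<eta> lam0 r0 \<open>- t < _\<close>)+
  qed
  with null show ?thesis by blast
qed

text \<open>
  The points \<open>Y k z\<close> are chosen from a countable set, so that \<open>z \<mapsto> gmean \<Omega> (Y k z) u\<close> is Borel.
\<close>
lemma measurable_approach_points:
  fixes \<Omega> \<Gamma> :: "'a::euclidean_space set"
  assumes \<Omega>: "open \<Omega>" "\<Gamma> \<subseteq> frontier \<Omega>" and \<delta>': "0 < \<delta>'"
    and \<theta>: "\<theta> \<in> borel_measurable (restrict_space borel \<Gamma>)"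
    and lam: "0 < lam" and corkscrew: "\<And>z \<delta>. z \<in> \<Gamma> \<Longrightarrow> 0 < \<delta> \<Longrightarrow> \<delta> \<le> \<delta>' \<Longrightarrow>
      \<exists>x\<in>Qreg \<Omega> \<theta> lam z. norm (z - x) < \<delta>"
  shows "\<exists>Y :: nat \<Rightarrow> 'a \<Rightarrow> 'a.
    (\<forall>k (g :: 'a \<Rightarrow> real). (\<lambda>z. g (Y k z)) \<in> borel_measurable (restrict_space borel \<Gamma>)) \<and>
    (\<forall>z\<in>\<Gamma>. filterlim (\<lambda>k. Y k z) (at z within Qreg \<Omega> \<theta> lam z) sequentially)"
proof -
  obtain E :: "'a set" where E: "countable E" "\<And>X. open X \<Longrightarrow> X \<noteq> {} \<Longrightarrow> \<exists>d\<in>E. d \<in> X"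
    using countable_dense_exists by blast
  define q where "q = from_nat_into E"
  have "E \<noteq> {}" using E(2)[of UNIV] by auto
  then have dense: "\<exists>j. q j \<in> X" if "open X" "X \<noteq> {}" for X
    using E(2)[OF that] E(1) by (metis from_nat_into_surj q_def)
  define A where "A k z j \<longleftrightarrow> q j \<in> Qreg \<Omega> \<theta> lam z \<and> norm (z - q j) < 1 / real (Suc k)" for k z j
  define Y where "Y k z = q (LEAST j. A k z j)" for k z
  have meas: "(\<lambda>z. g (Y k z)) \<in> borel_measurable (restrict_space borel \<Gamma>)" for k and g :: "'a \<Rightarrow> real"
  proof -
    have [measurable]: "(\<lambda>z. z) \<in> borel_measurable (restrict_space borel \<Gamma>)"
      by (rule measurable_restrict_space1) simp
    note \<theta>[measurable]
    have [measurable]: "Measurable.pred (restrict_space borel \<Gamma>) (\<lambda>z. A k z j)" for j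
      unfolding A_def Qreg_def mem_Collect_eq by measurable
    \<comment> \<open>The choice factors through a discrete countable space, so composing it with an
      arbitrary \<open>g\<close> stays Borel; regularity of the averages in x plays no part.\<close>
    have "(\<lambda>z. LEAST j. A k z j) \<in> measurable (restrict_space borel \<Gamma>) (count_space UNIV)"
      by measurable
    then show ?thesis
      unfolding Y_def by (rule measurable_compose[where g = "\<lambda>j. g (q j)"]) simp
  qed
  have "filterlim (\<lambda>k. Y k z) (at z within Qreg \<Omega> \<theta> lam z) sequentially" if z: "z \<in> \<Gamma>" for z
  proof -
    have "z \<notin> \<Omega>" using \<Omega> z by (auto simp: frontier_def interior_open)
    \<comment> \<open>Openness lets the countable dense set meet the region near \<open>z\<close>.
      Since \<open>z\<close> lies outside \<Omega>, the base of \<open>powr\<close> never vanishes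
      there, which gives continuity.\<close>
    have "open {x\<in>\<Omega>. 0 < bdist \<Omega> x - (lam * norm (z - x)) powr \<theta> z}"
    proof -
      have "continuous_on \<Omega> (\<lambda>x. bdist \<Omega> x - (lam * norm (z - x)) powr \<theta> z)"
        unfolding bdist_def using \<open>z \<notin> \<Omega>\<close> lam
        by (intro continuous_intros) auto
      then have "open (\<Omega> \<inter> (\<lambda>x. bdist \<Omega> x - (lam * norm (z - x)) powr \<theta> z) -` {0<..})"
        using \<Omega>(1) by (intro continuous_open_preimage) auto
      then show ?thesis by (simp add: Int_def vimage_def)
    qed
    then have "open (Qreg \<Omega> \<theta> lam z)" by (simp add: Qreg_def)
    have A: "A k z (LEAST j. A k z j)" for k
    proof -
      define \<delta> where "\<delta> = min \<delta>' (1 / real (Suc k))"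
      obtain x where "x \<in> Qreg \<Omega> \<theta> lam z" "norm (z - x) < \<delta>"
        using corkscrew[OF z, of \<delta>] \<delta>' by (auto simp: \<delta>_def)
      then have "Qreg \<Omega> \<theta> lam z \<inter> ball z (1 / real (Suc k)) \<noteq> {}"
        by (auto simp: \<delta>_def dist_norm)
      then obtain j where "q j \<in> Qreg \<Omega> \<theta> lam z \<inter> ball z (1 / real (Suc k))"
        using dense[of "Qreg \<Omega> \<theta> lam z \<inter> ball z (1 / real (Suc k))"] \<open>open (Qreg \<Omega> \<theta> lam z)\<close> by blast
      then have "A k z j" by (simp add: A_def dist_norm)
      then show ?thesis by (rule LeastI)
    qed
    have Y: "Y k z \<in> Qreg \<Omega> \<theta> lam z" "dist (Y k z) z < 1 / real (Suc k)" for k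
      using A[of k] by (auto simp: A_def Y_def dist_norm norm_minus_commute)
    have "(\<lambda>k. Y k z) \<longlonglongrightarrow> z"
      by (rule metric_tendsto_imp_tendsto[OF LIMSEQ_inverse_real_of_nat])
        (auto intro!: always_eventually less_imp_le[OF Y(2)[THEN order_less_le_trans]]
          simp: inverse_eq_divide)
    moreover have "Y k z \<noteq> z" for k using Y(1)[of k] \<open>z \<notin> \<Omega>\<close> by (auto simp: Qreg_def)
    ultimately show ?thesis using Y(1) by (simp add: filterlim_at)
  qed
  with meas show ?thesis by blast
qed

lemma vector_space_fun: "vector_space (\<lambda>(c::real) (f::'a \<Rightarrow> real) x. c * f x)"
  by unfold_locales (auto simp: fun_eq_iff algebra_simps)

theorem theorem1p1:
  fixes \<Omega> \<Gamma> :: "(real ^ 'n) set"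
    and p t \<delta>\<Gamma> :: real
    and s \<theta> :: "real ^ 'n \<Rightarrow> real"
  assumes "open \<Omega>"
    and "1 \<le> p"
    and "0 \<le> t" and "t < real CARD('n)"
    and "\<Gamma> \<subseteq> frontier \<Omega>" and "\<Gamma> \<in> sets borel" and "hausdorff_dim \<Gamma> = ennreal t"
    and "0 < \<delta>\<Gamma>" and "\<delta>\<Gamma> < 1"
    and "s \<in> borel_measurable (restrict_space borel \<Omega>)"
    and "\<And>x. x \<in> \<Omega> \<Longrightarrow> 0 \<le> s x" and "bounded (s ` \<Omega>)"
    and "\<theta> \<in> borel_measurable (restrict_space borel \<Gamma>)"
    and "\<And>z. z \<in> \<Gamma> \<Longrightarrow> 1 \<le> \<theta> z" and "bounded (\<theta> ` \<Gamma>)"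
    and "uniform_corkscrew \<Omega> \<Gamma> \<theta> \<delta>\<Gamma>"
    and "uniformly_connected \<Omega> \<Gamma> \<theta> \<delta>\<Gamma>"
    and "hausdorff t {z \<in> \<Gamma>. \<not> alpha_zero \<Omega> s p \<theta> z > - t} = 0"
  shows "\<exists>T :: (real ^ 'n \<Rightarrow> real) \<Rightarrow> real ^ 'n \<Rightarrow> real.
    linear_operator \<Omega> s p \<Gamma> T \<and>
    (\<forall>u \<in> Nspace \<Omega> s p. \<exists>\<Gamma>' \<subseteq> \<Gamma>.
       hausdorff_measurable t \<Gamma>' \<and> hausdorff t (\<Gamma> - \<Gamma>') = 0 \<and>
       (\<forall>z \<in> \<Gamma>'. \<forall>lam. 0 < lam \<and> lam < 1 \<longrightarrow>
          ((\<lambda>x. gmean \<Omega> x u) \<longlongrightarrow> T u z) (at z within Qreg \<Omega> \<theta> lam z)) \<and>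
       (\<forall>z \<in> \<Gamma>'. \<forall>\<beta>. 0 < \<beta> \<and> \<beta> < (alpha_zero \<Omega> s p \<theta> z + t) / p \<longrightarrow>
          (\<exists>\<delta>\<beta> > 0. \<forall>lam. 0 < lam \<and> lam < 1 \<longrightarrow>
             (\<exists>C. \<forall>x \<in> Qreg_loc \<Omega> \<theta> lam \<delta>\<beta> z.
                \<bar>T u z - gmean \<Omega> x u\<bar> \<le> C * norm (z - x) powr \<beta>))))"
proof -
  note \<Omega> = assms(1) and \<Gamma> = assms(5,6) and \<theta> = assms(13-15)
  let ?N = "Nspace \<Omega> s p" and ?b = "\<lambda>z. (alpha_zero \<Omega> s p \<theta> z + t) / p"
  obtain lam0 \<eta> where lam0: "0 < lam0" "lam0 < 1" and \<eta>: "0 < \<eta>" "\<eta> < 1"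
    and corkscrew: "\<forall>z\<in>\<Gamma>. \<forall>\<delta>. 0 < \<delta> \<longrightarrow> \<delta> \<le> \<delta>\<Gamma> \<longrightarrow>
      (\<exists>x\<in>Qreg \<Omega> \<theta> lam0 z. norm (z - x) < \<delta> \<and> bdist \<Omega> x > (\<eta> * \<delta>) powr \<theta> z)"
    by (rule uniform_corkscrewE[OF assms(16)])
  have "\<exists>x\<in>Qreg \<Omega> \<theta> lam0 z. norm (z - x) < \<delta>" if "z \<in> \<Gamma>" "0 < \<delta>" "\<delta> \<le> \<delta>\<Gamma>" for z \<delta>
    using corkscrew that by blast
  from measurable_approach_points[OF \<Omega> \<Gamma>(1) assms(8) \<theta>(1) lam0(1) this]
  obtain Y :: "nat \<Rightarrow> real ^ 'n \<Rightarrow> real ^ 'n" where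
    Y: "\<And>k (g :: real ^ 'n \<Rightarrow> real). (\<lambda>z. g (Y k z)) \<in> borel_measurable (restrict_space borel \<Gamma>)"
      "\<And>z. z \<in> \<Gamma> \<Longrightarrow> filterlim (\<lambda>k. Y k z) (at z within Qreg \<Omega> \<theta> lam0 z) sequentially"
    by blast
  \<comment> \<open>Borel on all of \<Gamma> for every \<open>u\<close>, since \<open>lim\<close>
    takes a constant unspecified value where the sequence diverges. Linearity can fail there, so
    \<open>T0\<close> is used on basis vectors only.\<close>
  define T0 where "T0 u z = lim (\<lambda>k. gmean \<Omega> (Y k z) u)" for u z
  have T0_borel: "T0 u \<in> Lspace \<Gamma>" for u
    unfolding Lspace_def T0_def by (intro borel_measurable_lim_metric Y(1))
  have T0_eq: "T0 u z = L" if z: "z \<in> \<Gamma>" and tr: "has_trace \<Omega> \<theta> (?b z) u z L" for u z L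
  proof -
    have "((\<lambda>x. gmean \<Omega> x u) \<longlongrightarrow> L) (at z within Qreg \<Omega> \<theta> lam0 z)"
      using tr lam0 by (simp add: has_trace_def)
    from filterlim_compose[OF this Y(2)[OF z]] show ?thesis
      unfolding T0_def by (rule limI)
  qed
  define Z where "Z = {w :: real ^ 'n \<Rightarrow> real. integrable (lebesgue_on \<Omega>) w \<and> (AE x in lebesgue_on \<Omega>. w x = 0)}"
  interpret VP: vector_space_pair
    "\<lambda>(c::real) (f::real ^ 'n \<Rightarrow> real) x. c * f x" "\<lambda>(c::real) (f::real ^ 'n \<Rightarrow> real) x. c * f x"
    unfolding vector_space_pair_def by (intro conjI vector_space_fun)
  obtain B0 where B0: "B0 \<subseteq> Z" "VP.vs1.independent B0" "Z \<subseteq> VP.vs1.span B0"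
    using VP.vs1.maximal_independent_subset by blast
  \<comment> \<open>The basis spans \<open>Z\<close> and \<open>?N\<close> together.
    \<open>T\<close> will be linear on all functions and its properties are proved on this whole
    span, which bypasses the question whether \<open>?N\<close> is a subspace containing
    \<open>Z\<close>.\<close>
  obtain B where B: "B0 \<subseteq> B" "B \<subseteq> Z \<union> ?N" "VP.vs1.independent B" "Z \<union> ?N \<subseteq> VP.vs1.span B"
    using VP.vs1.maximal_independent_subset_extend[OF order_trans[OF B0(1) Un_upper1] B0(2)] by blast
  obtain T where lin: "Vector_Spaces.linear (\<lambda>(c::real) (f::real ^ 'n \<Rightarrow> real) x. c * f x)
      (\<lambda>(c::real) (f::real ^ 'n \<Rightarrow> real) x. c * f x) T"
    and TB: "\<And>b. b \<in> B \<Longrightarrow> T b = (if b \<in> Z then 0 else T0 b)"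
    using VP.linear_independent_extend[OF B(3), of "\<lambda>b. if b \<in> Z then 0 else T0 b"] by blast
  have T_add: "T (u + v) = T u + T v" and T_scale: "T (\<lambda>x. c * u x) = (\<lambda>z. c * T u z)" for u v c
    using module_hom.add[OF Vector_Spaces.linear.axioms(3)[OF lin]]
      module_hom.scale[OF Vector_Spaces.linear.axioms(3)[OF lin]] by blast+
  have T_0: "T 0 = 0"
    using T_scale[of 0 0] by (simp add: zero_fun_def)
  have T_Z: "T w = 0" if "w \<in> Z" for w
  proof (rule VP.vs1.span_induct[where P = "\<lambda>w. T w = 0"])
    show "w \<in> VP.vs1.span B0" using B0(3) that by blast
    show "VP.vs1.subspace (Collect (\<lambda>w. T w = 0))"
      by (auto simp: VP.vs1.subspace_def T_0[unfolded zero_fun_def] T_add T_scale zero_fun_def)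
    show "T b = 0" if "b \<in> B0" for b using TB[of b] subsetD[OF B0(1) that] subsetD[OF B(1) that] by simp
  qed
  \<comment> \<open>The invariant for induction over the span. Integrability is carried along
    because the additivity of \<open>gmean\<close> needs it; the null set may depend on
    \<open>u\<close> and is enlarged by a union at each sum.\<close>
  define P where "P u \<longleftrightarrow> integrable (lebesgue_on \<Omega>) u \<and> T u \<in> Lspace \<Gamma> \<and>
    (\<exists>N. hausdorff t N = 0 \<and> (\<forall>z\<in>\<Gamma> - N. has_trace \<Omega> \<theta> (?b z) u z (T u z)))" for u
  have P_Z: "P u" if "u \<in> Z" for u
    using that T_Z[OF that] has_trace_null[OF \<Omega>, of u \<theta> _ _]
    by (auto simp: P_def Z_def Lspace_def zero_fun_def intro!: exI[of _ "{}"])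
  have P_basis: "P b" if b: "b \<in> B" for b
  proof (cases "b \<in> Z")
    case False
    then have bN: "b \<in> ?N" and Tb: "T b = T0 b" using b B(2) TB[OF b] by auto
    obtain N where N: "hausdorff t N = 0" "\<forall>z\<in>\<Gamma> - N. \<exists>L. has_trace \<Omega> \<theta> (?b z) b z L"
      using has_trace_ae[OF \<Omega> \<Gamma>(1) assms(2,3,8,11,12) \<theta>(2) assms(16-18) bN] by blast
    have "has_trace \<Omega> \<theta> (?b z) b z (T b z)" if "z \<in> \<Gamma> - N" for z
      using N(2) T0_eq[of z b] that Tb by fastforce
    then show ?thesis
      using N(1) T0_borel[of b] bN Tb by (auto simp: P_def Nspace_def)
  qed (rule P_Z)
  have P: "P u" if "u \<in> Z \<union> ?N" for u
  proof (rule VP.vs1.span_induct[where P = P])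
    show "u \<in> VP.vs1.span B" using B(4) that by blast
    show "VP.vs1.subspace (Collect P)"
      unfolding VP.vs1.subspace_def mem_Collect_eq
    proof (intro conjI ballI allI)
      show "P 0" by (rule P_Z) (simp add: Z_def zero_fun_def)
      fix u assume u: "u \<in> Collect P"
      then obtain N where N: "hausdorff t N = 0" "\<And>z. z \<in> \<Gamma> - N \<Longrightarrow> has_trace \<Omega> \<theta> (?b z) u z (T u z)"
        by (auto simp: P_def)
      show "P (\<lambda>x. c * u x)" for c
        using u N has_trace_scale[OF N(2)] unfolding P_def T_scale by (auto simp: Lspace_def)
      fix v assume v: "v \<in> Collect P"
      then obtain M where M: "hausdorff t M = 0" "\<And>z. z \<in> \<Gamma> - M \<Longrightarrow> has_trace \<Omega> \<theta> (?b z) v z (T v z)"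
        by (auto simp: P_def)
      have int: "integrable (lebesgue_on \<Omega>) u" "integrable (lebesgue_on \<Omega>) v"
        using u v by (auto simp: P_def)
      have "has_trace \<Omega> \<theta> (?b z) (u + v) z (T (u + v) z)" if "z \<in> \<Gamma> - (N \<union> M)" for z
        unfolding T_add using has_trace_add[OF \<Omega> int N(2) M(2)] that by (simp add: plus_fun_def)
      then show "P (u + v)"
        using u v hausdorff_null_Un[OF N(1) M(1)] unfolding P_def T_add
        by (auto simp: Lspace_def plus_fun_def)
    qed
  qed (rule P_basis)
  show ?thesis
  proof (rule exI[of _ T], rule conjI)
    show "linear_operator \<Omega> s p \<Gamma> T"
      unfolding linear_operator_def
    proof (intro conjI ballI allI impI)
      show "T u \<in> Lspace \<Gamma>" if "u \<in> ?N" for u using P[of u] that by (simp add: P_def)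
      show "T (\<lambda>x. u x + v x) z = T u z + T v z" for u v z
        using T_add[of u v] by (simp add: plus_fun_def)
      show "T (\<lambda>x. c * u x) z = c * T u z" for c u z by (simp add: T_scale)
      fix u v z assume uv: "u \<in> ?N" "v \<in> ?N" and eq: "AE x in lebesgue_on \<Omega>. u x = v x"
      have "u - v \<in> Z"
        using uv eq by (auto simp: Z_def Nspace_def fun_diff_def)
      then have "T u = T v"
        using T_Z[of "u - v"] T_add[of "u - v" v] by simp
      then show "T u z = T v z" by simp
    qed
    show "\<forall>u\<in>?N. \<exists>\<Gamma>'\<subseteq>\<Gamma>. hausdorff_measurable t \<Gamma>' \<and> hausdorff t (\<Gamma> - \<Gamma>') = 0 \<and>
       (\<forall>z \<in> \<Gamma>'. \<forall>lam. 0 < lam \<and> lam < 1 \<longrightarrow>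
          ((\<lambda>x. gmean \<Omega> x u) \<longlongrightarrow> T u z) (at z within Qreg \<Omega> \<theta> lam z)) \<and>
       (\<forall>z \<in> \<Gamma>'. \<forall>\<beta>. 0 < \<beta> \<and> \<beta> < (alpha_zero \<Omega> s p \<theta> z + t) / p \<longrightarrow>
          (\<exists>\<delta>\<beta> > 0. \<forall>lam. 0 < lam \<and> lam < 1 \<longrightarrow>
             (\<exists>C. \<forall>x \<in> Qreg_loc \<Omega> \<theta> lam \<delta>\<beta> z.
                \<bar>T u z - gmean \<Omega> x u\<bar> \<le> C * norm (z - x) powr \<beta>)))"
    proof
      fix u assume "u \<in> ?N"
      with P[of u] obtain N where N: "hausdorff t N = 0"
          "\<And>z. z \<in> \<Gamma> - N \<Longrightarrow> has_trace \<Omega> \<theta> (?b z) u z (T u z)"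
        by (auto simp: P_def)
      have "hausdorff t (\<Gamma> - (\<Gamma> - N)) = 0"
        using hausdorff_mono[of "\<Gamma> - (\<Gamma> - N)" N t] N(1) by auto
      moreover have "hausdorff_measurable t (\<Gamma> - N)"
        by (intro hausdorff_measurable_Diff hausdorff_measurable_borel hausdorff_null_measurable \<Gamma> N)
      ultimately show "\<exists>\<Gamma>'\<subseteq>\<Gamma>. hausdorff_measurable t \<Gamma>' \<and> hausdorff t (\<Gamma> - \<Gamma>') = 0 \<and>
         (\<forall>z \<in> \<Gamma>'. \<forall>lam. 0 < lam \<and> lam < 1 \<longrightarrow>
            ((\<lambda>x. gmean \<Omega> x u) \<longlongrightarrow> T u z) (at z within Qreg \<Omega> \<theta> lam z)) \<and>
         (\<forall>z \<in> \<Gamma>'. \<forall>\<beta>. 0 < \<beta> \<and> \<beta> < (alpha_zero \<Omega> s p \<theta> z + t) / p \<longrightarrow>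
            (\<exists>\<delta>\<beta> > 0. \<forall>lam. 0 < lam \<and> lam < 1 \<longrightarrow>
               (\<exists>C. \<forall>x \<in> Qreg_loc \<Omega> \<theta> lam \<delta>\<beta> z.
                  \<bar>T u z - gmean \<Omega> x u\<bar> \<le> C * norm (z - x) powr \<beta>)))"
        using N(2)[unfolded has_trace_def]
        by (intro exI[of _ "\<Gamma> - N"] conjI ballI Diff_subset) blast+
    qed
  qed
qed

end
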